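(* For $j=1,2$ let $G_j$ be an $r_j$-regular connected graph with $p_j$ vertices and $q_j$ edges, with $r_1\ge 2$. Let $r_1,\lambda_2,\ldots,\lambda_{p_1}$ and $r_2,\beta_2,\ldots,\beta_{p_2}$ be the adjacency eigenvalues (with multiplicity) of $G_1$ and $G_2$ respectively. Then the eigenvalues (with multiplicity) of $\epsilon(G_1\,\dot\vee\,G_2)$ consist of: 1. $4$, with multiplicity $q_1-p_1$; 2. $-2(1+\beta_k)$, for $k=2,3,\ldots,p_2$; 3. $-3t_1+4-4(\lambda_i+r_1)$, for $i=2,3,\ldots,p_1$, where $t_1=\frac{2(1-(\lambda_i+r_1))+\sqrt{4(\lambda_i+r_1)^2+(\lambda_i+r_1)+4}}{3}$; 4. $-3t_2+4-4(\lambda_i+r_1)$, for $i=2,3,\ldots,p_1$, where $t_2=\frac{2(1-(\lambda_i+r_1))-\sqrt{4(\lambda_i+r_1)^2+(\lambda_i+r_1)+4}}{3}$; 5. the three eigenvalues of the matrix $$\begin{pmatrix}0&3q_1-3r_1&0\\3p_1-6&4q_1-8r_1+4&2p_2\\0&2q_1&2(p_2-r_2-1)\end{pmatrix}$$ (the equitable quotient matrix of $\epsilon(G_1\,\dot\vee\,G_2)$).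
   Context: All graphs are finite, simple and undirected. The subdivision graph $S(G)$ of a graph $G$ is obtained from $G$ by subdividing each edge with one new vertex; $I(G)$ is the set of these new vertices, so $V(S(G))=V(G)\cup I(G)$. For vertex-disjoint graphs $G_1,G_2$, the subdivision-vertex join $G_1\,\dot\vee\,G_2$ is obtained from $S(G_1)$ and $G_2$ by joining each vertex of $V(G_1)$ to every vertex of $V(G_2)$. For a connected graph $G$ with distance function $d$, the eccentricity of a vertex $v$ is $e(v)=\max\{d(v,u):u\in V(G)\}$. The eccentricity matrix $\epsilon(G)$ is the symmetric matrix indexed by $V(G)$ with $(u,v)$ entry $d(u,v)$ if $d(u,v)=\min\{e(u),e(v)\}$, and $0$ otherwise. The quotient matrix in item 5 is taken with respect to the partition $V(G_1)\cup I(G_1)\cup V(G_2)$. *)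

theory Defs
  imports
    "Graph_Theory.Graph_Theory"
    "Jordan_Normal_Form.Char_Poly"
    "HOL-Library.Disjoint_Sets"
begin

text \<open>
  A finite simple undirected graph is a \<^locale>\<open>pair_graph\<close>: a finite symmetric loop-free set of
  ordered pairs. Each undirected edge is thus a pair of opposite arcs, and the edge set proper
  consists of the two-element sets of end points.
\<close>

definition edges :: "'a pair_pre_digraph \<Rightarrow> 'a set set" where
  "edges G = (\<lambda>(u, v). {u, v}) ` parcs G"

text \<open>In a symmetric loop-free digraph the out-degree of a vertex is its degree.\<close>

definition regular :: "nat \<Rightarrow> 'a pair_pre_digraph \<Rightarrow> bool" where
  "regular r G \<longleftrightarrow> (\<forall>v \<in> pverts G. out_degree (with_proj G) v = r)"

text \<open>The new vertex subdividing the edge \<open>e\<close> is \<^term>\<open>Inr e\<close>.\<close>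

definition subdivision_graph :: "'a pair_pre_digraph \<Rightarrow> ('a + 'a set) pair_pre_digraph" where
  "subdivision_graph G =
     \<lparr> pverts = Inl ` pverts G \<union> Inr ` edges G,
       parcs = {(Inl v, Inr e) | v e. e \<in> edges G \<and> v \<in> e}
             \<union> {(Inr e, Inl v) | v e. e \<in> edges G \<and> v \<in> e} \<rparr>"

definition subdivision_vertex_join ::
    "'a pair_pre_digraph \<Rightarrow> 'b pair_pre_digraph \<Rightarrow> (('a + 'a set) + 'b) pair_pre_digraph" where
  "subdivision_vertex_join G1 G2 =
     \<lparr> pverts = Inl ` pverts (subdivision_graph G1) \<union> Inr ` pverts G2,
       parcs = map_prod Inl Inl ` parcs (subdivision_graph G1)
             \<union> map_prod Inr Inr ` parcs G2
             \<union> {(Inl (Inl v), Inr w) | v w. v \<in> pverts G1 \<and> w \<in> pverts G2}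
             \<union> {(Inr w, Inl (Inl v)) | v w. v \<in> pverts G1 \<and> w \<in> pverts G2} \<rparr>"

definition graph_dist :: "'a pair_pre_digraph \<Rightarrow> 'a \<Rightarrow> 'a \<Rightarrow> ereal" where
  "graph_dist G u v = wf_digraph.\<mu> (with_proj G) (\<lambda>_. 1) u v"

definition eccentricity :: "'a pair_pre_digraph \<Rightarrow> 'a \<Rightarrow> ereal" where
  "eccentricity G v = Max (graph_dist G v ` pverts G)"

definition ecc_entry :: "'a pair_pre_digraph \<Rightarrow> 'a \<Rightarrow> 'a \<Rightarrow> real" where
  "ecc_entry G u v =
     (if graph_dist G u v = min (eccentricity G u) (eccentricity G v)
      then real_of_ereal (graph_dist G u v) else 0)"

definition adj_entry :: "'a pair_pre_digraph \<Rightarrow> 'a \<Rightarrow> 'a \<Rightarrow> real" where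
  "adj_entry G u v = (if (u, v) \<in> parcs G then 1 else 0)"

text \<open>
  A matrix indexed by the vertices listed in \<open>vs\<close>; a different order of the vertices gives a
  permutation-similar matrix.
\<close>

definition vertex_mat :: "'v list \<Rightarrow> ('v \<Rightarrow> 'v \<Rightarrow> real) \<Rightarrow> real mat" where
  "vertex_mat vs M = mat (length vs) (length vs) (\<lambda>(i, j). M (vs ! i) (vs ! j))"

text \<open>All complex eigenvalues, with algebraic multiplicity.\<close>

definition eigenvalues_mset :: "real mat \<Rightarrow> complex multiset" where
  "eigenvalues_mset A = proots (char_poly (map_mat complex_of_real A))"

text \<open>
  \<open>Vs\<close> is an equitable partition of the index set \<open>V\<close> of \<open>M\<close>, that is, all row sums within a block
  are equal, and \<open>Q\<close> is the resulting quotient matrix.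
\<close>

definition equitable_quotient ::
    "'v set \<Rightarrow> ('v \<Rightarrow> 'v \<Rightarrow> real) \<Rightarrow> 'v set list \<Rightarrow> real mat \<Rightarrow> bool" where
  "equitable_quotient V M Vs Q \<longleftrightarrow>
     partition_on V (set Vs) \<and> distinct Vs \<and> Q \<in> carrier_mat (length Vs) (length Vs) \<and>
     (\<forall>i < length Vs. \<forall>j < length Vs. \<forall>u \<in> Vs ! i. (\<Sum>v \<in> Vs ! j. M u v) = Q $$ (i, j))"

lemma finite_edges: "pair_graph G \<Longrightarrow> finite (edges G)"
  by (simp add: edges_def pair_fin_digraph.pair_finite_arcs pair_digraph.axioms(1)
      pair_graph.axioms(1))

lemma edges_subset: "pair_graph G \<Longrightarrow> e \<in> edges G \<Longrightarrow> e \<subseteq> pverts G"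
proof -
  assume "pair_graph G" and e: "e \<in> edges G"
  then interpret pair_graph G by simp
  show ?thesis using e arc_fst_in_verts[of "(_, _)"] arc_snd_in_verts[of "(_, _)"]
    by (auto simp: edges_def)
qed

lemma symmetric_pair_iff: "symmetric (with_proj G) \<longleftrightarrow> sym (parcs G)"
  by (simp add: symmetric_def)

lemma pair_graph_intro:
  assumes "finite (pverts G)" "parcs G \<subseteq> pverts G \<times> pverts G" "sym (parcs G)"
    "\<And>u. (u, u) \<notin> parcs G"
  shows "pair_graph G"
proof
  show "finite (parcs G)" using assms(1,2) finite_subset by blast
qed (use assms in \<open>auto simp: symmetric_pair_iff\<close>)

lemma pair_graph_subdivision_graph:
  assumes "pair_graph G" shows "pair_graph (subdivision_graph G)"
proof -
  interpret pair_graph G by fact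
  show ?thesis
    by (rule pair_graph_intro)
      (use finite_edges[OF assms] edges_subset[OF assms] pair_finite_verts in
        \<open>auto simp: subdivision_graph_def sym_def\<close>)
qed

lemma pair_graph_subdivision_vertex_join:
  assumes "pair_graph G1" "pair_graph G2"
  shows "pair_graph (subdivision_vertex_join G1 G2)"
proof -
  interpret S: pair_graph "subdivision_graph G1"
    by (rule pair_graph_subdivision_graph) fact
  interpret G2: pair_graph G2 by fact
  have symS: "(v, u) \<in> parcs (subdivision_graph G1)" if "(u, v) \<in> parcs (subdivision_graph G1)" for u v
    using S.pair_sym_arcs that by (auto simp: symmetric_pair_iff sym_def)
  have sym2: "(v, u) \<in> parcs G2" if "(u, v) \<in> parcs G2" for u v
    using G2.pair_sym_arcs that by (auto simp: symmetric_pair_iff sym_def)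
  have V1: "Inl v \<in> pverts (subdivision_graph G1)" if "v \<in> pverts G1" for v
    using that by (simp add: subdivision_graph_def)
  show ?thesis
  proof (rule pair_graph_intro)
    show "finite (pverts (subdivision_vertex_join G1 G2))"
      using S.pair_finite_verts G2.pair_finite_verts by (simp add: subdivision_vertex_join_def)
    show "parcs (subdivision_vertex_join G1 G2)
        \<subseteq> pverts (subdivision_vertex_join G1 G2) \<times> pverts (subdivision_vertex_join G1 G2)"
      using S.arc_fst_in_verts[of "(_, _)"] S.arc_snd_in_verts[of "(_, _)"]
        G2.arc_fst_in_verts[of "(_, _)"] G2.arc_snd_in_verts[of "(_, _)"] V1
      by (auto simp: subdivision_vertex_join_def)
    show "sym (parcs (subdivision_vertex_join G1 G2))"
      using symS sym2 by (intro symI) (auto simp: subdivision_vertex_join_def map_prod_imageI)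
    show "(u, u) \<notin> parcs (subdivision_vertex_join G1 G2)" for u
      using S.pair_no_loops[of "(_, _)"] G2.pair_no_loops[of "(_, _)"]
      by (auto simp: subdivision_vertex_join_def)
  qed
qed

end

theory Submission
  imports Defs
begin

text \<open>
  Let \<open>R\<close> be the vertex-edge incidence matrix and \<open>A\<^sub>1\<close> the adjacency matrix of \<open>G1\<close>, and \<open>A\<^sub>2\<close> the
  adjacency matrix of \<open>G2\<close>. With respect to \<open>V(G1) \<union> I(G1) \<union> V(G2)\<close> the eccentricity matrix is a
  block-constant matrix plus the matrix with diagonal blocks \<open>((0, -3R), (-3R\<^sup>T, 4(I - R\<^sup>TR)))\<close> and
  \<open>-2(I + A\<^sub>2)\<close>. Adding a block-constant matrix changes an equitable matrix only on the span of the
  indicator vectors of the blocks, so in the characteristic polynomial it merely replaces the factor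
  of the one quotient matrix by that of the other. The first diagonal block is handled by a Schur
  complement, which involves only \<open>RR\<^sup>T = A\<^sub>1 + r1 I\<close>; its factors for the eigenvalue \<open>r1\<close> of \<open>A\<^sub>1\<close>,
  together with the factor for the eigenvalue \<open>r2\<close> of \<open>A\<^sub>2\<close>, are those of the quotient matrix that is
  replaced.
\<close>

section \<open>Determinants of block matrices\<close>

text \<open>The block matrix \<open>((P, S), (D, 1))\<close> is triangularised in two ways. Clearing
  \<open>S\<close> by rows gives \<open>det (P - S * D)\<close>; clearing it by columns is possible
  because \<open>P * S = S * X\<close>, and leaves \<open>det P * det (X - D * S)\<close> at the
  price of a factor \<open>det X\<close>. No inverse of \<open>P\<close> or \<open>X\<close> occurs,
  so singular matrices are covered as well.\<close>

lemma det_intertwining: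
  fixes P :: "'a :: idom mat"
  assumes P: "P \<in> carrier_mat n n" and S: "S \<in> carrier_mat n k" and D: "D \<in> carrier_mat k n"
    and X: "X \<in> carrier_mat k k" and PS: "P * S = S * X"
  shows "det (P - S * D) * det X = det P * det (X - D * S)"
proof -
  let ?M = "four_block_mat P S D (1\<^sub>m k)"
  let ?U = "four_block_mat (1\<^sub>m n) S (0\<^sub>m k n) (1\<^sub>m k)"
  let ?L = "four_block_mat (P - S * D) (0\<^sub>m n k) D (1\<^sub>m k)"
  let ?W = "four_block_mat (1\<^sub>m n) (- S) (0\<^sub>m k n) X"
  have PSD: "P - S * D \<in> carrier_mat n n" using P S D by auto
  have M: "?M \<in> carrier_mat (n + k) (n + k)" and U: "?U \<in> carrier_mat (n + k) (n + k)"
    and L: "?L \<in> carrier_mat (n + k) (n + k)" and W: "?W \<in> carrier_mat (n + k) (n + k)"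
    using P S D X by auto
  have "?U * ?L = four_block_mat (1\<^sub>m n * (P - S * D) + S * D) (1\<^sub>m n * 0\<^sub>m n k + S * 1\<^sub>m k)
      (0\<^sub>m k n * (P - S * D) + 1\<^sub>m k * D) (0\<^sub>m k n * 0\<^sub>m n k + 1\<^sub>m k * 1\<^sub>m k)"
    by (rule mult_four_block_mat[OF one_carrier_mat S zero_carrier_mat one_carrier_mat PSD
        zero_carrier_mat D one_carrier_mat])
  also have "1\<^sub>m n * (P - S * D) + S * D = P"
    using P S D by (intro eq_matI) auto
  also have "1\<^sub>m n * 0\<^sub>m n k + S * 1\<^sub>m k = S" using S by (intro eq_matI) auto
  also have "0\<^sub>m k n * (P - S * D) + 1\<^sub>m k * D = D" using D PSD by (intro eq_matI) auto
  also have "0\<^sub>m k n * 0\<^sub>m n k + 1\<^sub>m k * 1\<^sub>m k = (1\<^sub>m k :: 'a mat)" by simp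
  finally have "det ?M = det ?U * det ?L" using det_mult[OF U L] by simp
  also have "det ?U = 1"
    by (subst det_four_block_mat_lower_left_zero[of _ n _ k]) (use S in auto)
  also have "det ?L = det (P - S * D)"
    by (subst det_four_block_mat_upper_right_zero[of _ n _ k]) (use PSD D in auto)
  finally have 1: "det ?M = det (P - S * D)" by simp
  \<comment> \<open>The upper right block of the product is \<open>- P * S + S * X\<close>, which
    vanishes by the intertwining relation.\<close>
  have "?M * ?W = four_block_mat (P * 1\<^sub>m n + S * 0\<^sub>m k n) (P * (- S) + S * X)
      (D * 1\<^sub>m n + 1\<^sub>m k * 0\<^sub>m k n) (D * (- S) + 1\<^sub>m k * X)"
    by (rule mult_four_block_mat) (use P S D X in auto)
  also have "P * 1\<^sub>m n + S * 0\<^sub>m k n = P" using P S by (intro eq_matI) auto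
  also have "P * (- S) + S * X = 0\<^sub>m n k"
    using P S X by (simp add: PS[symmetric])
  also have "D * 1\<^sub>m n + 1\<^sub>m k * 0\<^sub>m k n = D" using D by (intro eq_matI) auto
  also have "D * (- S) + 1\<^sub>m k * X = X - D * S" using D S X by (intro eq_matI) auto
  finally have "det ?M * det ?W = det (four_block_mat P (0\<^sub>m n k) D (X - D * S))"
    using det_mult[OF M W] by simp
  also have "\<dots> = det P * det (X - D * S)"
    by (rule det_four_block_mat_upper_right_zero) (use P D S X in auto)
  also have "det ?W = det X"
    by (subst det_four_block_mat_lower_left_zero[of _ n _ k]) (use S X in auto)
  finally show ?thesis using 1 by simp
qed

text \<open>This is the Schur complement of the block \<open>y I\<close> with denominators cleared:
  multiplying on the right by \<open>((y I, 0), (-C, I))\<close>, of determinant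
  \<open>y ^ p\<close>, removes the lower left block. Hence the identity also holds for
  \<open>y = 0\<close>.\<close>

lemma det_four_block_scalar_diag:
  fixes B :: "'a :: idom mat"
  assumes B: "B \<in> carrier_mat p q" and C: "C \<in> carrier_mat q p"
  shows "det (four_block_mat (a \<cdot>\<^sub>m 1\<^sub>m p) B C (y \<cdot>\<^sub>m 1\<^sub>m q)) * y ^ p
    = y ^ q * det ((a * y) \<cdot>\<^sub>m 1\<^sub>m p - B * C)"
proof -
  let ?M = "four_block_mat (a \<cdot>\<^sub>m 1\<^sub>m p) B C (y \<cdot>\<^sub>m 1\<^sub>m q)"
  let ?W = "four_block_mat (y \<cdot>\<^sub>m 1\<^sub>m p) (0\<^sub>m p q) (- C) (1\<^sub>m q)"
  have M: "?M \<in> carrier_mat (p + q) (p + q)" and W: "?W \<in> carrier_mat (p + q) (p + q)"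
    using B C by auto
  have "?M * ?W = four_block_mat (a \<cdot>\<^sub>m 1\<^sub>m p * (y \<cdot>\<^sub>m 1\<^sub>m p) + B * (- C)) (a \<cdot>\<^sub>m 1\<^sub>m p * 0\<^sub>m p q + B * 1\<^sub>m q)
      (C * (y \<cdot>\<^sub>m 1\<^sub>m p) + y \<cdot>\<^sub>m 1\<^sub>m q * (- C)) (C * 0\<^sub>m p q + y \<cdot>\<^sub>m 1\<^sub>m q * 1\<^sub>m q)"
    by (rule mult_four_block_mat) (use B C in auto)
  also have "a \<cdot>\<^sub>m 1\<^sub>m p * (y \<cdot>\<^sub>m 1\<^sub>m p) + B * (- C) = (a * y) \<cdot>\<^sub>m 1\<^sub>m p - B * C"
    using B C by (intro eq_matI) auto
  also have "a \<cdot>\<^sub>m 1\<^sub>m p * 0\<^sub>m p q + B * 1\<^sub>m q = B" using B by (intro eq_matI) auto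
  also have "C * (y \<cdot>\<^sub>m 1\<^sub>m p) + y \<cdot>\<^sub>m 1\<^sub>m q * (- C) = 0\<^sub>m q p"
    using C by (intro eq_matI) (auto simp: mult_smult_distrib[of C q p "1\<^sub>m p" p] mult.commute)
  also have "C * 0\<^sub>m p q + y \<cdot>\<^sub>m 1\<^sub>m q * 1\<^sub>m q = y \<cdot>\<^sub>m 1\<^sub>m q" using C by (intro eq_matI) auto
  finally have "det ?M * det ?W = det (four_block_mat ((a * y) \<cdot>\<^sub>m 1\<^sub>m p - B * C) B (0\<^sub>m q p) (y \<cdot>\<^sub>m 1\<^sub>m q))"
    using det_mult[OF M W] by simp
  also have "\<dots> = det ((a * y) \<cdot>\<^sub>m 1\<^sub>m p - B * C) * y ^ q"
    by (subst det_four_block_mat_lower_left_zero[of _ p _ q]) (use B C in auto)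
  also have "det ?W = y ^ p"
    by (subst det_four_block_mat_upper_right_zero[of _ p _ q]) (use B C in auto)
  finally show ?thesis by simp
qed

text \<open>The term \<open>d C B\<close> in the last block is \<open>(d / b) C\<close> times the
  block \<open>b B\<close> above it, so one row operation removes it. The same operation turns the
  coefficient \<open>b\<close> of \<open>C\<close> into \<open>b - d / b * x\<close>, and what
  remains has scalar diagonal blocks.\<close>

lemma det_incidence_block:
  fixes B :: "'a :: field mat"
  assumes B: "B \<in> carrier_mat p q" and C: "C \<in> carrier_mat q p" and b: "b \<noteq> 0"
  shows "det (four_block_mat (x \<cdot>\<^sub>m 1\<^sub>m p) (b \<cdot>\<^sub>m B) (b \<cdot>\<^sub>m C) (y \<cdot>\<^sub>m 1\<^sub>m q + d \<cdot>\<^sub>m (C * B))) * y ^ p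
    = y ^ q * det ((x * y) \<cdot>\<^sub>m 1\<^sub>m p - (b\<^sup>2 - d * x) \<cdot>\<^sub>m (B * C))"
proof -
  let ?L = "four_block_mat (1\<^sub>m p) (0\<^sub>m p q) ((d / b) \<cdot>\<^sub>m C) (1\<^sub>m q)"
  let ?N = "four_block_mat (x \<cdot>\<^sub>m 1\<^sub>m p) (b \<cdot>\<^sub>m B) ((b - d / b * x) \<cdot>\<^sub>m C) (y \<cdot>\<^sub>m 1\<^sub>m q)"
  have L: "?L \<in> carrier_mat (p + q) (p + q)" and N: "?N \<in> carrier_mat (p + q) (p + q)"
    using B C by auto
  have "?L * ?N = four_block_mat (1\<^sub>m p * (x \<cdot>\<^sub>m 1\<^sub>m p) + 0\<^sub>m p q * ((b - d / b * x) \<cdot>\<^sub>m C))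
     (1\<^sub>m p * (b \<cdot>\<^sub>m B) + 0\<^sub>m p q * (y \<cdot>\<^sub>m 1\<^sub>m q))
     ((d / b) \<cdot>\<^sub>m C * (x \<cdot>\<^sub>m 1\<^sub>m p) + 1\<^sub>m q * ((b - d / b * x) \<cdot>\<^sub>m C))
     ((d / b) \<cdot>\<^sub>m C * (b \<cdot>\<^sub>m B) + 1\<^sub>m q * (y \<cdot>\<^sub>m 1\<^sub>m q))"
    by (rule mult_four_block_mat) (use B C in auto)
  also have "1\<^sub>m p * (x \<cdot>\<^sub>m 1\<^sub>m p) + 0\<^sub>m p q * ((b - d / b * x) \<cdot>\<^sub>m C) = x \<cdot>\<^sub>m 1\<^sub>m p"
    using C by (intro eq_matI) auto
  also have "1\<^sub>m p * (b \<cdot>\<^sub>m B) + 0\<^sub>m p q * (y \<cdot>\<^sub>m 1\<^sub>m q) = b \<cdot>\<^sub>m B"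
    using B by (intro eq_matI) auto
  also have "(d / b) \<cdot>\<^sub>m C * (x \<cdot>\<^sub>m 1\<^sub>m p) + 1\<^sub>m q * ((b - d / b * x) \<cdot>\<^sub>m C) = b \<cdot>\<^sub>m C"
    using C by (intro eq_matI)
      (auto simp: mult_smult_distrib[of "(d / b) \<cdot>\<^sub>m C" q p "1\<^sub>m p" p] algebra_simps)
  also have "(d / b) \<cdot>\<^sub>m C * (b \<cdot>\<^sub>m B) + 1\<^sub>m q * (y \<cdot>\<^sub>m 1\<^sub>m q) = y \<cdot>\<^sub>m 1\<^sub>m q + d \<cdot>\<^sub>m (C * B)"
    using B C b by (intro eq_matI) (auto simp: algebra_simps)
  finally have "det (four_block_mat (x \<cdot>\<^sub>m 1\<^sub>m p) (b \<cdot>\<^sub>m B) (b \<cdot>\<^sub>m C) (y \<cdot>\<^sub>m 1\<^sub>m q + d \<cdot>\<^sub>m (C * B))) = det ?L * det ?N"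
    using det_mult[OF L N] by simp
  also have "det ?L = 1"
    by (subst det_four_block_mat_upper_right_zero[of _ p _ q]) (use B C in auto)
  finally have "det (four_block_mat (x \<cdot>\<^sub>m 1\<^sub>m p) (b \<cdot>\<^sub>m B) (b \<cdot>\<^sub>m C) (y \<cdot>\<^sub>m 1\<^sub>m q + d \<cdot>\<^sub>m (C * B))) * y ^ p = det ?N * y ^ p"
    by simp
  also have "\<dots> = y ^ q * det ((x * y) \<cdot>\<^sub>m 1\<^sub>m p - (b \<cdot>\<^sub>m B) * ((b - d / b * x) \<cdot>\<^sub>m C))"
    by (rule det_four_block_scalar_diag) (use B C in auto)
  also have "(b \<cdot>\<^sub>m B) * ((b - d / b * x) \<cdot>\<^sub>m C) = (b\<^sup>2 - d * x) \<cdot>\<^sub>m (B * C)"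
    using B C b by (intro eq_matI) (auto simp: algebra_simps power2_eq_square)
  finally show ?thesis .
qed

section \<open>Characteristic polynomials as products over their roots\<close>

lemma proots_prod_linear_factors:
  fixes f :: "'b \<Rightarrow> 'a :: idom"
  shows "proots (\<Prod>a\<in>#A. [:- f a, 1:]) = image_mset f A"
proof (induction A)
  case (add a A)
  have "(\<Prod>a\<in>#A. [:- f a, 1:]) \<noteq> 0" by (auto simp: prod_mset_zero_iff)
  with add show ?case by (simp add: proots_mult del: mult_pCons_left)
qed simp

lemma char_poly_nonzero: "A \<in> carrier_mat n n \<Longrightarrow> char_poly A \<noteq> (0 :: 'a :: {comm_ring_1, zero_neq_one} poly)"
  using degree_monic_char_poly[of A n] by auto

lemma char_poly_eq_prod_proots:
  fixes A :: "complex mat"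
  assumes "A \<in> carrier_mat n n"
  shows "char_poly A = (\<Prod>a\<in>#proots (char_poly A). [:- a, 1:])"
proof -
  obtain as where "char_poly A = (\<Prod>a\<leftarrow>as. [:- a, 1:])"
    using char_poly_factorized[OF assms] by blast
  then have "char_poly A = (\<Prod>a\<in>#mset as. [:- a, 1:])"
    by (simp add: prod_mset_prod_list flip: mset_map)
  then show ?thesis using proots_prod_linear_factors[of "\<lambda>a. a" "mset as"] by simp
qed

text \<open>For \<open>g\<close> nonzero this is \<open>g ^ n\<close> times the characteristic
  polynomial at \<open>f / g\<close>, with one \<open>g\<close> moved into each of the
  \<open>n\<close> linear factors. Below, \<open>f\<close> and \<open>g\<close> are functions of
  \<open>x\<close> and \<open>g\<close> can vanish, hence the separate case
  \<open>g = 0\<close>.\<close>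

lemma det_scalar_minus_smult:
  fixes A :: "complex mat"
  assumes A: "A \<in> carrier_mat n n"
  shows "det (f \<cdot>\<^sub>m 1\<^sub>m n - g \<cdot>\<^sub>m A) = (\<Prod>a\<in>#proots (char_poly A). f - g * a)"
proof -
  have sz: "size (proots (char_poly A)) = n"
    using degree_monic_char_poly[OF A] by (simp add: size_proots_complex)
  show ?thesis
  proof (cases "g = 0")
    case True
    then have "f \<cdot>\<^sub>m 1\<^sub>m n - g \<cdot>\<^sub>m A = f \<cdot>\<^sub>m 1\<^sub>m n" using A by (intro eq_matI) auto
    then show ?thesis using True sz by simp
  next
    case False
    have "f \<cdot>\<^sub>m 1\<^sub>m n - g \<cdot>\<^sub>m A = g \<cdot>\<^sub>m (- char_matrix A (f / g))"
      using A False by (intro eq_matI) (auto simp: char_matrix_def algebra_simps)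
    then have "det (f \<cdot>\<^sub>m 1\<^sub>m n - g \<cdot>\<^sub>m A) = g ^ n * poly (char_poly A) (f / g)"
      using A by (simp add: char_poly_matrix[OF A] char_matrix_def)
    also have "poly (char_poly A) (f / g) = (\<Prod>a\<in>#proots (char_poly A). f / g - a)"
      by (subst char_poly_eq_prod_proots[OF A]) (simp add: poly_prod_mset image_mset.compositionality o_def)
    also have "g ^ n * \<dots> = (\<Prod>a\<in>#proots (char_poly A). g * (f / g - a))"
      by (subst prod_mset.distrib) (simp add: sz)
    finally show ?thesis using False by (simp add: algebra_simps)
  qed
qed

section \<open>Matrices indexed by lists\<close>

text \<open>Rectangular and over any entry type, so that incidence matrices, block indicator
  matrices and the blocks of an appended list all have this form.\<close>

definition indexed_mat :: "'u list \<Rightarrow> 'v list \<Rightarrow> ('u \<Rightarrow> 'v \<Rightarrow> 'c) \<Rightarrow> 'c mat" where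
  "indexed_mat us vs M = mat (length us) (length vs) (\<lambda>(i, j). M (us ! i) (vs ! j))"

lemma indexed_mat_carrier [simp]: "indexed_mat us vs M \<in> carrier_mat (length us) (length vs)"
  and dim_row_indexed_mat [simp]: "dim_row (indexed_mat us vs M) = length us"
  and dim_col_indexed_mat [simp]: "dim_col (indexed_mat us vs M) = length vs"
  and index_indexed_mat [simp]:
    "i < length us \<Longrightarrow> j < length vs \<Longrightarrow> indexed_mat us vs M $$ (i, j) = M (us ! i) (vs ! j)"
  by (auto simp: indexed_mat_def)

lemma indexed_mat_cong:
  assumes "\<And>u v. u \<in> set us \<Longrightarrow> v \<in> set vs \<Longrightarrow> M u v = N u v"
  shows "indexed_mat us vs M = indexed_mat us vs N"
  using assms by (intro eq_matI) auto

lemma sum_indicator_mult: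
  fixes f :: "'b \<Rightarrow> 'c :: comm_semiring_1"
  assumes "finite A" "a \<in> A"
  shows "(\<Sum>i\<in>A. (if a = i then 1 else 0) * f i) = f a"
    and "(\<Sum>i\<in>A. f i * (if i = a then 1 else 0)) = f a"
proof -
  have "(\<Sum>i\<in>A. (if a = i then 1 else 0) * f i) = (\<Sum>i\<in>A. if a = i then f i else 0)"
    by (rule sum.cong) auto
  then show "(\<Sum>i\<in>A. (if a = i then 1 else 0) * f i) = f a" using assms by simp
  have "(\<Sum>i\<in>A. f i * (if i = a then 1 else 0)) = (\<Sum>i\<in>A. if a = i then f i else 0)"
    by (rule sum.cong) auto
  then show "(\<Sum>i\<in>A. f i * (if i = a then 1 else 0)) = f a" using assms by simp
qed

lemma indexed_mat_mult:
  fixes M :: "'u \<Rightarrow> 'v \<Rightarrow> 'c :: comm_semiring_1"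
  assumes "distinct vs"
  shows "indexed_mat us vs M * indexed_mat vs ws N = indexed_mat us ws (\<lambda>u w. \<Sum>v\<in>set vs. M u v * N v w)"
proof (rule eq_matI; simp)
  fix i j assume "i < length us" "j < length ws"
  then have "row (indexed_mat us vs M) i \<bullet> col (indexed_mat vs ws N) j
      = (\<Sum>l<length vs. M (us ! i) (vs ! l) * N (vs ! l) (ws ! j))"
    by (simp add: scalar_prod_def atLeast0LessThan)
  also have "\<dots> = (\<Sum>v\<in>set vs. M (us ! i) v * N v (ws ! j))"
    by (rule sum.reindex_bij_betw[OF bij_betw_nth]) (use assms in auto)
  finally show "row (indexed_mat us vs M) i \<bullet> col (indexed_mat vs ws N) j = \<dots>" .
qed

lemma one_mat_eq_indexed_mat:
  "distinct vs \<Longrightarrow> 1\<^sub>m (length vs) = indexed_mat vs vs (\<lambda>u v. if u = v then 1 else 0)"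
  by (intro eq_matI) (auto simp: nth_eq_iff_index_eq)

lemma indexed_mat_map:
  "indexed_mat (map f us) (map g vs) M = indexed_mat us vs (\<lambda>u v. M (f u) (g v))"
  by (intro eq_matI) auto

lemma minus_indexed_mat: "indexed_mat us vs M - indexed_mat us vs N = indexed_mat us vs (\<lambda>u v. M u v - N u v)"
  and plus_indexed_mat: "indexed_mat us vs M + indexed_mat us vs N = indexed_mat us vs (\<lambda>u v. M u v + N u v)"
  and smult_indexed_mat: "c \<cdot>\<^sub>m indexed_mat us vs M = indexed_mat us vs (\<lambda>u v. c * M u v)"
  by (auto intro!: eq_matI)

lemma indexed_mat_append:
  "indexed_mat (us @ us') (vs @ vs') M
    = four_block_mat (indexed_mat us vs M) (indexed_mat us vs' M) (indexed_mat us' vs M) (indexed_mat us' vs' M)"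
  by (intro eq_matI) (auto simp: nth_append)

lemma indexed_mat_eq_zero:
  "(\<And>u v. u \<in> set us \<Longrightarrow> v \<in> set vs \<Longrightarrow> M u v = 0) \<Longrightarrow>
    indexed_mat us vs M = 0\<^sub>m (length us) (length vs)"
  by (intro eq_matI) auto

text \<open>The two matrices are similar through the permutation matrix, written here as the
  equality indicator between the two lists.\<close>

lemma char_poly_indexed_mat_reorder:
  fixes M :: "'v \<Rightarrow> 'v \<Rightarrow> 'c :: comm_ring_1"
  assumes "distinct us" "distinct vs" "set us = set vs"
  shows "char_poly (indexed_mat us us M) = char_poly (indexed_mat vs vs M)"
proof (rule char_poly_similar)
  let ?E = "\<lambda>u v. if u = v then 1 else 0 :: 'c"
  have len: "length us = length vs" using assms by (metis distinct_card)
  have "similar_mat_wit (indexed_mat us us M) (indexed_mat vs vs M) (indexed_mat us vs ?E) (indexed_mat vs us ?E)"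
  proof (rule similar_mat_witI)
    show "indexed_mat us vs ?E * indexed_mat vs us ?E = 1\<^sub>m (length us)"
      unfolding indexed_mat_mult[OF assms(2)] one_mat_eq_indexed_mat[OF assms(1)]
      by (rule indexed_mat_cong) (simp add: assms sum_indicator_mult)
    show "indexed_mat vs us ?E * indexed_mat us vs ?E = 1\<^sub>m (length us)"
      unfolding indexed_mat_mult[OF assms(1)] len one_mat_eq_indexed_mat[OF assms(2)]
      by (rule indexed_mat_cong) (simp add: assms sum_indicator_mult)
    show "indexed_mat us us M = indexed_mat us vs ?E * indexed_mat vs vs M * indexed_mat vs us ?E"
      unfolding indexed_mat_mult[OF assms(2)]
      by (rule indexed_mat_cong) (simp add: assms sum_indicator_mult)
  qed (simp_all add: len carrier_matI)
  then show "similar_mat (indexed_mat us us M) (indexed_mat vs vs M)"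
    by (auto simp: similar_mat_def)
qed

lemma eigenvalues_mset_vertex_mat:
  "eigenvalues_mset (vertex_mat vs M) = proots (char_poly (indexed_mat vs vs (\<lambda>u v. complex_of_real (M u v))))"
proof -
  have "map_mat complex_of_real (vertex_mat vs M) = indexed_mat vs vs (\<lambda>u v. complex_of_real (M u v))"
    by (rule eq_matI) (auto simp: vertex_mat_def)
  then show ?thesis by (simp add: eigenvalues_mset_def)
qed

lemma poly_char_poly_indexed_mat:
  fixes M :: "'v \<Rightarrow> 'v \<Rightarrow> 'c :: field"
  assumes "distinct vs"
  shows "poly (char_poly (indexed_mat vs vs M)) x
    = det (indexed_mat vs vs (\<lambda>u v. (if u = v then x else 0) - M u v))"
proof -
  have "- char_matrix (indexed_mat vs vs M) x = indexed_mat vs vs (\<lambda>u v. (if u = v then x else 0) - M u v)"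
    using assms by (intro eq_matI) (auto simp: char_matrix_def nth_eq_iff_index_eq)
  then show ?thesis by (simp add: char_poly_matrix[OF indexed_mat_carrier])
qed

text \<open>Let \<open>S\<close> be the indicator matrix of the blocks. Equitability of
  \<open>N\<close> says \<open>N S = S R\<close>, and the block-constant summand factors as
  \<open>S D\<close> with \<open>D S\<close> equal to \<open>C\<close> scaled by the block sizes. So
  \<open>det_intertwining\<close> applies to \<open>x I - N\<close> and \<open>x I - R\<close> for
  each value \<open>x\<close>, and equality at all points of an infinite field gives equality of
  polynomials.\<close>

lemma char_poly_add_block_constant:
  fixes M N :: "'v \<Rightarrow> 'v \<Rightarrow> 'c :: field_char_0" and bs :: "'b list" and bl :: "'v \<Rightarrow> 'b"
  assumes vs: "distinct vs" and bs: "distinct bs" and bl: "bl ` set vs \<subseteq> set bs"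
    and M: "\<And>u v. u \<in> set vs \<Longrightarrow> v \<in> set vs \<Longrightarrow> M u v = N u v + C (bl u) (bl v)"
    and N: "\<And>u j. u \<in> set vs \<Longrightarrow> j \<in> set bs \<Longrightarrow> (\<Sum>v | v \<in> set vs \<and> bl v = j. N u v) = R (bl u) j"
    and Q: "\<And>i j. i \<in> set bs \<Longrightarrow> j \<in> set bs \<Longrightarrow>
      Q i j = R i j + C i j * of_nat (card {v \<in> set vs. bl v = j})"
  shows "char_poly (indexed_mat vs vs M) * char_poly (indexed_mat bs bs R)
    = char_poly (indexed_mat vs vs N) * char_poly (indexed_mat bs bs Q)"
proof (rule poly_eq_poly_eq_iff[THEN iffD1], rule ext)
  fix x :: 'c
  let ?X = "\<lambda>K u v. (if u = v then x else 0) - K u v"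
  let ?S = "\<lambda>v j. if bl v = j then 1 else 0 :: 'c"
  define P where "P = indexed_mat vs vs (\<lambda>u v. ?X N u v)"
  define S where "S = indexed_mat vs bs ?S"
  define D where "D = indexed_mat bs vs (\<lambda>i v. C i (bl v))"
  define X where "X = indexed_mat bs bs (\<lambda>i j. ?X R i j)"
  have "P * S = indexed_mat vs bs (\<lambda>u j. (if bl u = j then x else 0) - R (bl u) j)"
    unfolding P_def S_def indexed_mat_mult[OF vs]
  proof (rule indexed_mat_cong)
    fix u j assume u: "u \<in> set vs" and j: "j \<in> set bs"
    have "(\<Sum>v\<in>set vs. ?X N u v * ?S v j)
      = (\<Sum>v\<in>set vs. if u = v then x * ?S v j else 0) - (\<Sum>v\<in>set vs. if bl v = j then N u v else 0)"
      by (subst sum_subtractf[symmetric]) (auto intro!: sum.cong simp: algebra_simps)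
    also have "(\<Sum>v\<in>set vs. if bl v = j then N u v else 0) = R (bl u) j"
      using N[OF u j] by (simp add: sum.inter_filter)
    finally show "(\<Sum>v\<in>set vs. ?X N u v * ?S v j) = (if bl u = j then x else 0) - R (bl u) j"
      using u by simp
  qed
  also have "\<dots> = S * X"
    unfolding S_def X_def indexed_mat_mult[OF bs]
  proof (rule indexed_mat_cong)
    fix u j assume u: "u \<in> set vs" and j: "j \<in> set bs"
    have "bl u \<in> set bs" using bl u by auto
    then show "(if bl u = j then x else 0) - R (bl u) j = (\<Sum>i\<in>set bs. ?S u i * ?X R i j)"
      by (simp add: sum_indicator_mult)
  qed
  finally have PS: "P * S = S * X" .
  have "P - S * D = indexed_mat vs vs (?X M)"
    unfolding P_def S_def D_def indexed_mat_mult[OF bs] minus_indexed_mat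
  proof (rule indexed_mat_cong)
    fix u v assume u: "u \<in> set vs" and v: "v \<in> set vs"
    have "bl u \<in> set bs" using bl u by auto
    then have "(\<Sum>i\<in>set bs. ?S u i * C i (bl v)) = C (bl u) (bl v)"
      by (simp add: sum_indicator_mult)
    then show "?X N u v - (\<Sum>i\<in>set bs. ?S u i * C i (bl v)) = ?X M u v"
      using M[OF u v] by simp
  qed
  moreover have "X - D * S = indexed_mat bs bs (?X Q)"
    unfolding X_def S_def D_def indexed_mat_mult[OF vs] minus_indexed_mat
  proof (rule indexed_mat_cong)
    fix i j assume ij: "i \<in> set bs" "j \<in> set bs"
    have "(\<Sum>v\<in>set vs. C i (bl v) * ?S v j) = (\<Sum>v | v \<in> set vs \<and> bl v = j. C i j)"
      by (subst sum.inter_filter) (auto intro!: sum.cong)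
    then show "?X R i j - (\<Sum>v\<in>set vs. C i (bl v) * ?S v j) = ?X Q i j"
      using Q[OF ij] by (simp add: mult.commute)
  qed
  moreover have "det (P - S * D) * det X = det P * det (X - D * S)"
    by (rule det_intertwining[OF _ _ _ _ PS]) (auto simp: P_def S_def D_def X_def)
  ultimately show "poly (char_poly (indexed_mat vs vs M) * char_poly (indexed_mat bs bs R)) x
      = poly (char_poly (indexed_mat vs vs N) * char_poly (indexed_mat bs bs Q)) x"
    by (simp add: poly_char_poly_indexed_mat[OF vs] poly_char_poly_indexed_mat[OF bs] P_def X_def)
qed

section \<open>Distances and incidences in graphs\<close>

text \<open>A distance function is certified locally. By \<open>step\<close>, \<open>d\<close> grows
  by at most one along each arc, so it bounds the length of every walk from \<open>u\<close> from
  below; by \<open>closer\<close>, predecessors can be followed back to \<open>u\<close>, which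
  yields a walk of length exactly \<open>d x\<close>.\<close>

lemma graph_dist_eqI:
  assumes G: "pair_graph G" and u: "u \<in> pverts G" and x: "x \<in> pverts G" and d0: "d u = 0"
    and step: "\<And>a b. (a, b) \<in> parcs G \<Longrightarrow> d b \<le> Suc (d a)"
    and closer: "\<And>b. b \<in> pverts G \<Longrightarrow> b \<noteq> u \<Longrightarrow> \<exists>a. (a, b) \<in> parcs G \<and> d b = Suc (d a)"
  shows "graph_dist G u x = ereal (real (d x))"
proof -
  interpret pair_graph G by fact
  have cost: "awalk_cost (\<lambda>_. 1) p = real (length p)" for p :: "('a \<times> 'a) list"
    by (simp add: awalk_cost_def sum_list_triv)
  have lower: "d v \<le> d a + length p" if "awalk a p v" for a p v
    using that
  proof (induction p arbitrary: a)
    case (Cons e p)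
    then obtain b where e: "e = (a, b)" "(a, b) \<in> parcs G" "awalk b p v"
      by (cases e) (auto simp: awalk_Cons_iff)
    with Cons.IH[of b] step[of a b] show ?case by simp
  qed (simp add: awalk_Nil_iff)
  have upper: "\<exists>p. awalk u p v \<and> length p = d v" if "v \<in> pverts G" for v
    using that
  proof (induction "d v" arbitrary: v)
    case 0
    then have "v = u" using closer[of v] by fastforce
    then show ?case using u d0 by (intro exI[of _ "[]"]) (simp add: awalk_Nil_iff)
  next
    case (Suc n)
    then obtain a where a: "(a, v) \<in> parcs G" "d v = Suc (d a)" using closer[of v] d0 by fastforce
    moreover from a have "a \<in> pverts G" by (auto dest: in_arcsD1)
    ultimately obtain p where "awalk u p a" "length p = d a" using Suc by auto
    moreover from a Suc have "awalk a [(a, v)] v" by (auto simp: awalk_Cons_iff awalk_Nil_iff)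
    ultimately have "awalk u (p @ [(a, v)]) v \<and> length (p @ [(a, v)]) = d v"
      using a by (auto intro: awalk_appendI)
    then show ?case by blast
  qed
  obtain p where p: "awalk u p x" "length p = d x" using upper[OF x] by blast
  show ?thesis
    unfolding graph_dist_def
  proof (rule antisym)
    show "\<mu> (\<lambda>_. 1) u x \<le> ereal (real (d x))"
      using min_cost_le_walk_cost[OF p(1), of "\<lambda>_. 1"] p(2) by (simp add: cost)
    show "ereal (real (d x)) \<le> \<mu> (\<lambda>_. 1) u x"
      unfolding \<mu>_def using lower[of u _ x] d0 by (intro INF_greatest) (auto simp: cost)
  qed
qed

section \<open>Counting incidences in regular graphs\<close>

context pair_graph
begin

lemma sym_parcs: "(u, v) \<in> parcs G \<Longrightarrow> (v, u) \<in> parcs G"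
  using pair_sym_arcs by (auto simp: symmetric_pair_iff sym_def)

lemma edge_iff: "{u, v} \<in> edges G \<longleftrightarrow> (u, v) \<in> parcs G"
  by (auto simp: edges_def doubleton_eq_iff intro: sym_parcs)

lemma edgeE:
  assumes "e \<in> edges G"
  obtains u v where "e = {u, v}" "(u, v) \<in> parcs G" "u \<noteq> v"
  using assms pair_no_loops by (fastforce simp: edges_def)

lemma incident_edgeE:
  assumes "e \<in> edges G" "u \<in> e"
  obtains v where "e = {u, v}" "(u, v) \<in> parcs G" "u \<noteq> v"
  using assms by (elim edgeE) (auto intro: sym_parcs simp: insert_commute)

lemma card_edge: "e \<in> edges G \<Longrightarrow> card e = 2"
  by (auto elim!: edgeE)

text \<open>In a simple graph an edge through a given vertex is determined by its other end, so
  distinct edges share at most one vertex.\<close>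

lemma card_edge_inter:
  assumes "e \<in> edges G" "f \<in> edges G" "e \<noteq> f"
  shows "card (e \<inter> f) = (if e \<inter> f = {} then 0 else 1)"
proof (cases "e \<inter> f = {}")
  case False
  then obtain u where u: "u \<in> e" "u \<in> f" by blast
  obtain v where "e = {u, v}" using assms u by (elim incident_edgeE)
  moreover obtain w where "f = {u, w}" using assms u by (elim incident_edgeE)
  ultimately have "e \<inter> f = {u}" using assms(3) by auto
  then show ?thesis by simp
qed simp

lemma card_neighbours:
  assumes "regular r G" "u \<in> pverts G"
  shows "card {v. (u, v) \<in> parcs G} = r"
proof -
  have "r = card {e \<in> parcs G. fst e = u}"
    using assms by (simp add: regular_def out_degree_def out_arcs_def)
  also have "{e \<in> parcs G. fst e = u} = Pair u ` {v. (u, v) \<in> parcs G}" by auto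
  also have "card \<dots> = card {v. (u, v) \<in> parcs G}" by (rule card_image) (simp add: inj_on_def)
  finally show ?thesis by simp
qed

lemma card_incident_edges:
  assumes "regular r G" "u \<in> pverts G"
  shows "card {e \<in> edges G. u \<in> e} = r"
proof -
  have "{e \<in> edges G. u \<in> e} = (\<lambda>v. {u, v}) ` {v. (u, v) \<in> parcs G}"
    by (auto simp: edge_iff elim!: incident_edgeE)
  also have "card \<dots> = card {v. (u, v) \<in> parcs G}"
    by (rule card_image) (auto simp: inj_on_def doubleton_eq_iff)
  finally show ?thesis using card_neighbours[OF assms] by simp
qed

text \<open>These sums are the entries of the product of the incidence matrix with its transpose:
  the degree on the diagonal, and off it the single possible edge \<open>{u, v}\<close>. This is the
  identity \<open>R R^T = A + r I\<close>.\<close>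

lemma sum_incidence_edges:
  assumes r: "regular r G" and u: "u \<in> pverts G" and v: "v \<in> pverts G"
  shows "(\<Sum>e\<in>edges G. of_bool (u \<in> e) * of_bool (v \<in> e))
    = (of_nat (if u = v then r else of_bool ((u, v) \<in> parcs G)) :: 'c :: semiring_1)"
proof -
  have "finite (edges G)" using finite_edges pair_graph_axioms by blast
  then have "(\<Sum>e\<in>edges G. of_bool (u \<in> e) * of_bool (v \<in> e)) = (of_nat (card {e \<in> edges G. u \<in> e \<and> v \<in> e}) :: 'c)"
    by (simp flip: of_bool_conj add: Int_def)
  also have "card {e \<in> edges G. u \<in> e \<and> v \<in> e} = (if u = v then r else of_bool ((u, v) \<in> parcs G))"
  proof (cases "u = v")
    case True
    then show ?thesis using card_incident_edges[OF r u] by simp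
  next
    case False
    then have "{e \<in> edges G. u \<in> e \<and> v \<in> e} = (if (u, v) \<in> parcs G then {{u, v}} else {})"
      by (auto simp: edge_iff elim!: incident_edgeE)
    then show ?thesis using False by simp
  qed
  finally show ?thesis .
qed

lemma sum_incidence_verts:
  assumes "e \<in> edges G" "f \<in> edges G"
  shows "(\<Sum>v\<in>pverts G. of_bool (v \<in> e) * of_bool (v \<in> f)) = (of_nat (card (e \<inter> f)) :: 'c :: semiring_1)"
proof -
  have "(\<Sum>v\<in>pverts G. of_bool (v \<in> e) * of_bool (v \<in> f)) = (of_nat (card {v \<in> pverts G. v \<in> e \<and> v \<in> f}) :: 'c)"
    using pair_finite_verts by (simp flip: of_bool_conj add: Int_def)
  also have "{v \<in> pverts G. v \<in> e \<and> v \<in> f} = e \<inter> f"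
    using edges_subset[OF pair_graph_axioms] assms by blast
  finally show ?thesis .
qed

text \<open>Double counting of the pairs of a vertex and an edge through it.\<close>

lemma handshake:
  assumes "regular r G"
  shows "r * card (pverts G) = 2 * card (edges G)"
proof -
  have fin: "finite (edges G)" using finite_edges pair_graph_axioms by blast
  have "r * card (pverts G) = (\<Sum>u\<in>pverts G. card {e \<in> edges G. u \<in> e})"
    using card_incident_edges[OF assms] by simp
  also have "\<dots> = (\<Sum>u\<in>pverts G. \<Sum>e\<in>edges G. of_bool (u \<in> e))"
    using fin by (simp add: Int_def)
  also have "\<dots> = (\<Sum>e\<in>edges G. \<Sum>u\<in>pverts G. of_bool (u \<in> e))"
    by (rule sum.swap)
  also have "\<dots> = (\<Sum>e\<in>edges G. card {u \<in> pverts G. u \<in> e})"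
    using pair_finite_verts by (simp add: Int_def)
  also have "\<dots> = (\<Sum>e\<in>edges G. 2)"
  proof (rule sum.cong[OF refl])
    fix e assume e: "e \<in> edges G"
    then have "{u \<in> pverts G. u \<in> e} = e" using edges_subset[OF pair_graph_axioms] by blast
    then show "card {u \<in> pverts G. u \<in> e} = 2" using card_edge[OF e] by simp
  qed
  finally show ?thesis by simp
qed

lemma ex_other_neighbour:
  assumes "regular r G" "2 \<le> r" "u \<in> pverts G"
  shows "\<exists>v. (u, v) \<in> parcs G \<and> v \<noteq> w"
proof (rule ccontr)
  assume "\<not> ?thesis"
  then have "{v. (u, v) \<in> parcs G} \<subseteq> {w}" by auto
  then have "card {v. (u, v) \<in> parcs G} \<le> 1"
    using card_mono[of "{w}"] by simp
  then show False using card_neighbours[OF assms(1,3)] assms(2) by simp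
qed

text \<open>One end of the edge has a second neighbour, which lies off the edge. In the join that
  vertex is at distance 3 from the subdividing vertex of \<open>e\<close>.\<close>

lemma ex_vertex_notin_edge:
  assumes "regular r G" "2 \<le> r" "e \<in> edges G"
  shows "\<exists>v\<in>pverts G. v \<notin> e"
proof -
  obtain u w where e: "e = {u, w}" "(u, w) \<in> parcs G" using assms(3) by (elim edgeE)
  then have "u \<in> pverts G" by (auto dest: in_arcsD1)
  then obtain v where "(u, v) \<in> parcs G" "v \<noteq> w" using ex_other_neighbour[OF assms(1,2)] by blast
  then show ?thesis using e pair_no_loops by (fastforce dest: in_arcsD2)
qed

text \<open>A neighbour \<open>u\<close> of \<open>v\<close> has a neighbour \<open>w\<close> other
  than \<open>v\<close>, and the edge \<open>{u, w}\<close> avoids \<open>v\<close>.\<close>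

lemma ex_edge_avoiding:
  assumes "regular r G" "2 \<le> r" "v \<in> pverts G"
  shows "\<exists>e\<in>edges G. v \<notin> e"
proof -
  obtain u where u: "(v, u) \<in> parcs G" using ex_other_neighbour[OF assms] by blast
  then have "u \<in> pverts G" by (auto dest: in_arcsD2)
  then obtain w where "(u, w) \<in> parcs G" "w \<noteq> v" using ex_other_neighbour[OF assms(1,2)] by blast
  moreover have "v \<noteq> u" using pair_no_loops[OF u] by simp
  ultimately show ?thesis by (intro bexI[of _ "{u, w}"]) (auto simp: edge_iff)
qed

end

section \<open>Eccentricities in the subdivision-vertex join\<close>

lemma parcs_subdivision_vertex_join [simp]:
  "(Inl (Inl u), Inl (Inl v)) \<notin> parcs (subdivision_vertex_join G1 G2)"
  "(Inl (Inl v), Inl (Inr e)) \<in> parcs (subdivision_vertex_join G1 G2) \<longleftrightarrow> e \<in> edges G1 \<and> v \<in> e"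
  "(Inl (Inr e), Inl (Inl v)) \<in> parcs (subdivision_vertex_join G1 G2) \<longleftrightarrow> e \<in> edges G1 \<and> v \<in> e"
  "(Inl (Inr e), Inl (Inr f)) \<notin> parcs (subdivision_vertex_join G1 G2)"
  "(Inl (Inl v), Inr w) \<in> parcs (subdivision_vertex_join G1 G2) \<longleftrightarrow> v \<in> pverts G1 \<and> w \<in> pverts G2"
  "(Inr w, Inl (Inl v)) \<in> parcs (subdivision_vertex_join G1 G2) \<longleftrightarrow> v \<in> pverts G1 \<and> w \<in> pverts G2"
  "(Inl (Inr e), Inr w) \<notin> parcs (subdivision_vertex_join G1 G2)"
  "(Inr w, Inl (Inr e)) \<notin> parcs (subdivision_vertex_join G1 G2)"
  "(Inr w, Inr w') \<in> parcs (subdivision_vertex_join G1 G2) \<longleftrightarrow> (w, w') \<in> parcs G2"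
  by (auto simp: subdivision_vertex_join_def subdivision_graph_def)

lemma pverts_subdivision_vertex_join:
  "pverts (subdivision_vertex_join G1 G2) = Inl ` Inl ` pverts G1 \<union> Inl ` Inr ` edges G1 \<union> Inr ` pverts G2"
  by (auto simp: subdivision_vertex_join_def subdivision_graph_def)

text \<open>Any vertex of \<open>G2\<close> joins two vertices of \<open>G1\<close> in two steps,
  whatever their distance in \<open>G1\<close>. So a vertex reaches a non-incident edge in 2 + 1
  steps, and two disjoint edges are 1 + 2 + 1 steps apart; vertices of \<open>G2\<close> likewise
  meet through any vertex of \<open>G1\<close>.\<close>

fun join_dist :: "'b pair_pre_digraph \<Rightarrow> ('a + 'a set) + 'b \<Rightarrow> ('a + 'a set) + 'b \<Rightarrow> nat" where
  "join_dist G2 (Inl (Inl u)) (Inl (Inl v)) = (if u = v then 0 else 2)"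
| "join_dist G2 (Inl (Inl v)) (Inl (Inr e)) = (if v \<in> e then 1 else 3)"
| "join_dist G2 (Inl (Inr e)) (Inl (Inl v)) = (if v \<in> e then 1 else 3)"
| "join_dist G2 (Inl (Inr e)) (Inl (Inr f)) = (if e = f then 0 else if e \<inter> f \<noteq> {} then 2 else 4)"
| "join_dist G2 (Inl (Inl v)) (Inr w) = 1"
| "join_dist G2 (Inr w) (Inl (Inl v)) = 1"
| "join_dist G2 (Inl (Inr e)) (Inr w) = 2"
| "join_dist G2 (Inr w) (Inl (Inr e)) = 2"
| "join_dist G2 (Inr w) (Inr w') = (if w = w' then 0 else if (w, w') \<in> parcs G2 then 1 else 2)"

text \<open>The numbers are positions in the list \<open>blocks\<close> and row indices of the
  quotient matrix.\<close>

definition join_block :: "('a + 'a set) + 'b \<Rightarrow> nat" where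
  "join_block x = (case x of Inl (Inl _) \<Rightarrow> 0 | Inl (Inr _) \<Rightarrow> 1 | Inr _ \<Rightarrow> 2)"

lemma join_block_simps [simp]:
  "join_block (Inl (Inl v)) = 0" "join_block (Inl (Inr e)) = 1" "join_block (Inr w) = 2"
  by (simp_all add: join_block_def)

lemma join_vertex_cases:
  fixes x :: "('a + 'a set) + 'b"
  assumes "x \<in> pverts (subdivision_vertex_join G1 G2)"
  obtains (V) v where "v \<in> pverts G1" "x = Inl (Inl v)"
  | (E) e where "e \<in> edges G1" "x = Inl (Inr e)"
  | (W) w where "w \<in> pverts G2" "x = Inr w"
  using assms by (auto simp: pverts_subdivision_vertex_join)

text \<open>Nonempty vertex sets, which connectedness supplies, provide the intermediate vertices of
  the shortest paths in the join.\<close>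

locale regular_join =
  G1: pair_graph G1 + G2: pair_graph G2
  for G1 :: "'a pair_pre_digraph" and G2 :: "'b pair_pre_digraph" +
  fixes r1 r2 :: nat
  assumes reg1: "regular r1 G1" and r1: "2 \<le> r1" and V1: "pverts G1 \<noteq> {}"
    and reg2: "regular r2 G2" and V2: "pverts G2 \<noteq> {}"
begin

abbreviation H where "H \<equiv> subdivision_vertex_join G1 G2"

lemma edge_ends: "e \<in> edges G1 \<Longrightarrow> \<exists>v\<in>pverts G1. v \<in> e"
  by (auto elim!: G1.edgeE dest: G1.in_arcsD1)

lemma graph_dist_join:
  assumes x: "x \<in> pverts H" and y: "y \<in> pverts H"
  shows "graph_dist H x y = ereal (real (join_dist G2 x y))"
proof (rule graph_dist_eqI[OF pair_graph_subdivision_vertex_join x y])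
  show "pair_graph G1" "pair_graph G2" by unfold_locales
  show "join_dist G2 x x = 0" by (cases "(G2, x, x)" rule: join_dist.cases) auto
next
  fix a b assume ab: "(a, b) \<in> parcs H"
  show "join_dist G2 x b \<le> Suc (join_dist G2 x a)"
    using x
  proof (cases rule: join_vertex_cases)
    case (V v)
    then show ?thesis using ab by (cases "(G2, a, b)" rule: join_dist.cases) simp_all
  next
    case (E e)
    then show ?thesis using ab by (cases "(G2, a, b)" rule: join_dist.cases) (simp_all, blast)
  next
    case (W w)
    then show ?thesis using ab by (cases "(G2, a, b)" rule: join_dist.cases) simp_all
  qed
next
  fix b assume b: "b \<in> pverts H" "b \<noteq> x"
  \<comment> \<open>Arbitrary intermediate vertices: \<open>w0\<close> connects any two vertices of
    \<open>G1\<close>, and \<open>v0\<close> any two of \<open>G2\<close>. Each case below names the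
    last vertex before \<open>b\<close> on a shortest path from \<open>x\<close>.\<close>
  obtain v0 where v0: "v0 \<in> pverts G1" using V1 by blast
  obtain w0 where w0: "w0 \<in> pverts G2" using V2 by blast
  show "\<exists>a. (a, b) \<in> parcs H \<and> join_dist G2 x b = Suc (join_dist G2 x a)"
    using x
  proof (cases rule: join_vertex_cases)
    case (V v)
    show ?thesis
      using b(1)
    proof (cases rule: join_vertex_cases)
      case V': (V v')
      then show ?thesis using V b w0 by (intro exI[of _ "Inr w0"]) auto
    next
      case (E e)
      show ?thesis
      proof (cases "v \<in> e")
        case True
        then show ?thesis using V E by (intro exI[of _ "Inl (Inl v)"]) auto
      next
        case False
        moreover obtain v' where "v' \<in> e" using edge_ends E by blast
        ultimately show ?thesis using V E by (intro exI[of _ "Inl (Inl v')"]) auto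
      qed
    next
      case (W w)
      then show ?thesis using V by (intro exI[of _ "Inl (Inl v)"]) auto
    qed
  next
    case (E e)
    obtain x0 where x0: "x0 \<in> e" "x0 \<in> pverts G1" using edge_ends E by blast
    show ?thesis
      using b(1)
    proof (cases rule: join_vertex_cases)
      case (V v)
      show ?thesis
      proof (cases "v \<in> e")
        case True
        then show ?thesis using V E by (intro exI[of _ "Inl (Inr e)"]) auto
      next
        case False
        then show ?thesis using V E w0 by (intro exI[of _ "Inr w0"]) auto
      qed
    next
      case E': (E f)
      \<comment> \<open>The end \<open>y\<close> of \<open>f\<close> is taken in \<open>e\<close>
        whenever the edges meet. It is then at distance 1 from \<open>e\<close>, and at distance 3
        when the edges are disjoint.\<close>
      obtain y where "y \<in> f" "e \<inter> f \<noteq> {} \<longrightarrow> y \<in> e"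
        using edge_ends[OF E'(1)] by blast
      then show ?thesis using E E' b by (intro exI[of _ "Inl (Inl y)"]) auto
    next
      case (W w)
      then show ?thesis using E x0 by (intro exI[of _ "Inl (Inl x0)"]) auto
    qed
  next
    case (W w)
    show ?thesis
      using b(1)
    proof (cases rule: join_vertex_cases)
      case (V v)
      then show ?thesis using W by (intro exI[of _ "Inr w"]) auto
    next
      case (E e)
      obtain x0 where "x0 \<in> e" using edge_ends E by blast
      then show ?thesis using W E by (intro exI[of _ "Inl (Inl x0)"]) auto
    next
      case W': (W w')
      show ?thesis
      proof (cases "(w, w') \<in> parcs G2")
        case True
        then show ?thesis using W W' b by (intro exI[of _ "Inr w"]) auto
      next
        case False
        then show ?thesis using W W' b v0 by (intro exI[of _ "Inl (Inl v0)"]) auto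
      qed
    qed
  qed
qed

text \<open>A natural-number counterpart of \<open>eccentricity\<close>, so that comparisons with
  \<open>join_dist\<close> need no extended reals.\<close>

definition join_ecc :: "('a + 'a set) + 'b \<Rightarrow> nat" where
  "join_ecc x = Max (join_dist G2 x ` pverts H)"

lemma finite_pverts_join: "finite (pverts H)"
  using G1.pair_finite_verts G2.pair_finite_verts finite_edges[OF G1.pair_graph_axioms]
  by (simp add: pverts_subdivision_vertex_join)

lemma pverts_join_nonempty: "pverts H \<noteq> {}"
  using V1 by (simp add: pverts_subdivision_vertex_join)

lemma eccentricity_join:
  assumes "x \<in> pverts H"
  shows "eccentricity H x = ereal (real (join_ecc x))"
proof -
  have "eccentricity H x = Max ((\<lambda>n. ereal (real n)) ` join_dist G2 x ` pverts H)"
    unfolding eccentricity_def image_image using assms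
    by (intro arg_cong[where f = Max] image_cong) (simp_all add: graph_dist_join)
  also have "\<dots> = ereal (real (join_ecc x))"
    unfolding join_ecc_def using finite_pverts_join pverts_join_nonempty
    by (intro mono_Max_commute[symmetric]) (auto simp: mono_def)
  finally show ?thesis .
qed

lemma ecc_entry_join:
  assumes "x \<in> pverts H" "y \<in> pverts H"
  shows "ecc_entry H x y = (if join_dist G2 x y = min (join_ecc x) (join_ecc y) then real (join_dist G2 x y) else 0)"
proof -
  have "min (ereal (real m)) (ereal (real n)) = ereal (real (min m n))" for m n :: nat
    by (simp add: min_def)
  then show ?thesis
    using assms by (simp add: ecc_entry_def graph_dist_join eccentricity_join)
qed

lemma join_dist_le_ecc: "y \<in> pverts H \<Longrightarrow> join_dist G2 x y \<le> join_ecc x"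
  unfolding join_ecc_def using finite_pverts_join by (intro Max_ge) auto

lemma join_ecc_le: "(\<And>y. y \<in> pverts H \<Longrightarrow> join_dist G2 x y \<le> k) \<Longrightarrow> join_ecc x \<le> k"
  unfolding join_ecc_def using finite_pverts_join pverts_join_nonempty by (intro Max.boundedI) auto

lemma join_ecc_V:
  assumes "v \<in> pverts G1"
  shows "join_ecc (Inl (Inl v)) = 3"
proof (rule antisym)
  show "join_ecc (Inl (Inl v)) \<le> 3"
  proof (rule join_ecc_le)
    fix y assume "y \<in> pverts H"
    then show "join_dist G2 (Inl (Inl v)) y \<le> 3" by (cases rule: join_vertex_cases) auto
  qed
  obtain e where "e \<in> edges G1" "v \<notin> e" using G1.ex_edge_avoiding[OF reg1 r1 assms] by blast
  then show "3 \<le> join_ecc (Inl (Inl v))"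
    using join_dist_le_ecc[of "Inl (Inr e)" "Inl (Inl v)"] by (simp add: pverts_subdivision_vertex_join)
qed

text \<open>The value is 4 exactly if some edge is disjoint from \<open>e\<close>; for a triangle it
  is 3. The bounds settle every entry against a vertex of \<open>G1\<close> or \<open>G2\<close>,
  because those have eccentricities 3 and 2 and so already determine the minimum.\<close>

lemma join_ecc_E:
  assumes "e \<in> edges G1"
  shows "3 \<le> join_ecc (Inl (Inr e))" "join_ecc (Inl (Inr e)) \<le> 4"
proof -
  show "join_ecc (Inl (Inr e)) \<le> 4"
  proof (rule join_ecc_le)
    fix y assume "y \<in> pverts H"
    then show "join_dist G2 (Inl (Inr e)) y \<le> 4" by (cases rule: join_vertex_cases) auto
  qed
  obtain v where "v \<in> pverts G1" "v \<notin> e" using G1.ex_vertex_notin_edge[OF reg1 r1 assms] by blast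
  then show "3 \<le> join_ecc (Inl (Inr e))"
    using join_dist_le_ecc[of "Inl (Inl v)" "Inl (Inr e)"] by (simp add: pverts_subdivision_vertex_join)
qed

lemma join_ecc_W:
  assumes "w \<in> pverts G2"
  shows "join_ecc (Inr w) = 2"
proof (rule antisym)
  show "join_ecc (Inr w) \<le> 2"
  proof (rule join_ecc_le)
    fix y assume "y \<in> pverts H"
    then show "join_dist G2 (Inr w) y \<le> 2" by (cases rule: join_vertex_cases) auto
  qed
  obtain v where "v \<in> pverts G1" using V1 by blast
  then obtain e where "e \<in> edges G1" using G1.ex_edge_avoiding[OF reg1 r1] by blast
  then show "2 \<le> join_ecc (Inr w)"
    using join_dist_le_ecc[of "Inl (Inr e)" "Inr w"] by (simp add: pverts_subdivision_vertex_join)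
qed

lemma edges_nonempty: "edges G1 \<noteq> {}"
  using V1 G1.ex_edge_avoiding[OF reg1 r1] by blast

section \<open>Entries of the eccentricity matrix in closed form\<close>

lemma join_vertices [simp]:
  "v \<in> pverts G1 \<Longrightarrow> Inl (Inl v) \<in> pverts H"
  "e \<in> edges G1 \<Longrightarrow> Inl (Inr e) \<in> pverts H"
  "w \<in> pverts G2 \<Longrightarrow> Inr w \<in> pverts H"
  by (simp_all add: pverts_subdivision_vertex_join)

text \<open>Distances between vertices of \<open>G1\<close> are at most 2, below the common
  eccentricity 3.\<close>

lemma ecc_entry_VV: "u \<in> pverts G1 \<Longrightarrow> v \<in> pverts G1 \<Longrightarrow> ecc_entry H (Inl (Inl u)) (Inl (Inl v)) = 0"
  by (simp add: ecc_entry_join join_ecc_V)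

lemma ecc_entry_VW:
  assumes "v \<in> pverts G1" "w \<in> pverts G2"
  shows "ecc_entry H (Inl (Inl v)) (Inr w) = 0" "ecc_entry H (Inr w) (Inl (Inl v)) = 0"
  using assms by (simp_all add: ecc_entry_join join_ecc_V join_ecc_W)

lemma ecc_entry_VE:
  assumes "v \<in> pverts G1" "e \<in> edges G1"
  shows "ecc_entry H (Inl (Inl v)) (Inl (Inr e)) = 3 - 3 * of_bool (v \<in> e)"
    "ecc_entry H (Inl (Inr e)) (Inl (Inl v)) = 3 - 3 * of_bool (v \<in> e)"
  using assms join_ecc_E[of e] by (simp_all add: ecc_entry_join join_ecc_V)

lemma ecc_entry_EW:
  assumes "e \<in> edges G1" "w \<in> pverts G2"
  shows "ecc_entry H (Inl (Inr e)) (Inr w) = 2" "ecc_entry H (Inr w) (Inl (Inr e)) = 2"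
  using assms join_ecc_E[of e] by (simp_all add: ecc_entry_join join_ecc_W)

text \<open>Distance 2, the common eccentricity, is attained exactly at distinct non-adjacent pairs.
  The block is thus \<open>2 (J - I - A2)\<close> with \<open>J\<close> the all-ones matrix.\<close>

lemma ecc_entry_WW:
  assumes "w \<in> pverts G2" "w' \<in> pverts G2"
  shows "ecc_entry H (Inr w) (Inr w') = 2 - 2 * (of_bool (w = w') + adj_entry G2 w w')"
  using assms G2.pair_no_loops[of "(w, w)"] by (auto simp: ecc_entry_join join_ecc_W adj_entry_def)

text \<open>The formula unites three cases. Disjoint edges witness eccentricity 4 for each other and
  keep their distance 4; distinct edges that meet share one vertex and get 0; for
  \<open>e = f\<close> the term \<open>1 - 2\<close> cancels the leading 4.\<close>

lemma ecc_entry_EE: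
  assumes e: "e \<in> edges G1" and f: "f \<in> edges G1"
  shows "ecc_entry H (Inl (Inr e)) (Inl (Inr f)) = 4 + 4 * (of_bool (e = f) - real (card (e \<inter> f)))"
proof (cases "e \<inter> f = {}")
  case True
  then have "f \<inter> e = {}" by blast
  moreover from True have "e \<noteq> f" using G1.card_edge[OF e] by auto
  moreover have "4 \<le> join_ecc (Inl (Inr e))"
    using join_dist_le_ecc[of "Inl (Inr f)" "Inl (Inr e)"] f True \<open>e \<noteq> f\<close> by simp
  moreover have "4 \<le> join_ecc (Inl (Inr f))"
    using join_dist_le_ecc[of "Inl (Inr e)" "Inl (Inr f)"] e \<open>f \<inter> e = {}\<close> \<open>e \<noteq> f\<close> by simp
  ultimately show ?thesis
    using True e f join_ecc_E(2)[OF e] join_ecc_E(2)[OF f] by (simp add: ecc_entry_join)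
next
  case False
  \<comment> \<open>Edges that meet are at distance 2 or 0, whereas both eccentricities are at least
    3.\<close>
  have "min (join_ecc (Inl (Inr e))) (join_ecc (Inl (Inr f))) \<noteq> 2"
    using join_ecc_E(1)[OF e] join_ecc_E(1)[OF f] by (simp add: min_def)
  then show ?thesis
    using False e f G1.card_edge[OF e] G1.card_edge_inter[OF e f]
    by (cases "e = f") (simp_all add: ecc_entry_join)
qed

end

section \<open>The equitable quotient\<close>

context regular_join
begin

abbreviation p1 where "p1 \<equiv> card (pverts G1)"
abbreviation q1 where "q1 \<equiv> card (edges G1)"
abbreviation p2 where "p2 \<equiv> card (pverts G2)"

definition blocks :: "(('a + 'a set) + 'b) set list" where
  "blocks = [Inl ` Inl ` pverts G1, Inl ` Inr ` edges G1, Inr ` pverts G2]"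

definition quotient_mat :: "real mat" where
  "quotient_mat = mat_of_rows_list 3
     [[0, 3 * real q1 - 3 * real r1, 0],
      [3 * real p1 - 6, 4 * real q1 - 8 * real r1 + 4, 2 * real p2],
      [0, 2 * real q1, 2 * (real p2 - real r2 - 1)]]"

lemma quotient_mat_carrier: "quotient_mat \<in> carrier_mat 3 3"
  by (rule carrier_matI) (simp_all add: quotient_mat_def mat_of_rows_list_def)

lemma quotient_mat_simps:
    "quotient_mat $$ (0, 0) = 0"
    "quotient_mat $$ (0, Suc 0) = 3 * real q1 - 3 * real r1"
    "quotient_mat $$ (0, 2) = 0"
    "quotient_mat $$ (Suc 0, 0) = 3 * real p1 - 6"
    "quotient_mat $$ (Suc 0, Suc 0) = 4 * real q1 - 8 * real r1 + 4"
    "quotient_mat $$ (Suc 0, 2) = 2 * real p2"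
    "quotient_mat $$ (2, 0) = 0"
    "quotient_mat $$ (2, Suc 0) = 2 * real q1"
    "quotient_mat $$ (2, 2) = 2 * (real p2 - real r2 - 1)"
  by (simp_all add: quotient_mat_def mat_of_rows_list_def)

text \<open>After exchanging the sums, each of the two ends of \<open>e\<close> is counted once for
  each of its \<open>r1\<close> edges, \<open>e\<close> itself included.\<close>

lemma sum_edges_card_inter:
  assumes e: "e \<in> edges G1"
  shows "(\<Sum>f\<in>edges G1. real (card (e \<inter> f))) = 2 * real r1"
proof -
  have "(\<Sum>f\<in>edges G1. real (card (e \<inter> f)))
      = (\<Sum>f\<in>edges G1. \<Sum>v\<in>pverts G1. of_bool (v \<in> e) * of_bool (v \<in> f))"
    using e by (intro sum.cong[OF refl]) (rule G1.sum_incidence_verts[symmetric])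
  also have "\<dots> = (\<Sum>v\<in>pverts G1. of_bool (v \<in> e) * (\<Sum>f\<in>edges G1. of_bool (v \<in> f)))"
    by (subst sum.swap) (simp add: sum_distrib_left)
  also have "\<dots> = (\<Sum>v\<in>pverts G1. of_bool (v \<in> e) * real r1)"
  proof (rule sum.cong[OF refl])
    fix v assume "v \<in> pverts G1"
    then have "(\<Sum>f\<in>edges G1. of_bool (v \<in> f)) = real r1"
      using G1.card_incident_edges[OF reg1] finite_edges[OF G1.pair_graph_axioms]
      by (simp add: Int_def)
    then show "of_bool (v \<in> e) * (\<Sum>f\<in>edges G1. of_bool (v \<in> f)) = of_bool (v \<in> e) * real r1"
      by simp
  qed
  also have "\<dots> = real (card (pverts G1 \<inter> e)) * real r1"
    using G1.pair_finite_verts by (simp flip: sum_distrib_right add: Int_def)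
  also have "pverts G1 \<inter> e = e" using edges_subset[OF G1.pair_graph_axioms e] by blast
  finally show ?thesis using G1.card_edge[OF e] by simp
qed

text \<open>In each closed-form entry the constant contributes a multiple of the block size, and the
  correction has constant row sums: an edge has two ends, a vertex lies on \<open>r1\<close> edges,
  edge intersections add up to \<open>2 * r1\<close>, and a vertex of \<open>G2\<close> has
  \<open>r2\<close> neighbours.\<close>

lemma equitable_join: "equitable_quotient (pverts H) (ecc_entry H) blocks quotient_mat"
proof -
  have fE: "finite (edges G1)" using finite_edges[OF G1.pair_graph_axioms] .
  note fV = G1.pair_finite_verts and fW = G2.pair_finite_verts
  have VE: "(\<Sum>e\<in>edges G1. ecc_entry H (Inl (Inl v)) (Inl (Inr e))) = 3 * real q1 - 3 * real r1"
    if v: "v \<in> pverts G1" for v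
  proof -
    have "(\<Sum>e\<in>edges G1. of_bool (v \<in> e)) = real r1"
      using G1.card_incident_edges[OF reg1 v] fE by (simp add: Int_def)
    then show ?thesis using v by (simp add: ecc_entry_VE sum_subtractf flip: sum_distrib_left)
  qed
  have EV: "(\<Sum>v\<in>pverts G1. ecc_entry H (Inl (Inr e)) (Inl (Inl v))) = 3 * real p1 - 6"
    if e: "e \<in> edges G1" for e
  proof -
    have "pverts G1 \<inter> {v. v \<in> e} = e" using edges_subset[OF G1.pair_graph_axioms e] by blast
    then have "(\<Sum>v\<in>pverts G1. of_bool (v \<in> e)) = (2 :: real)"
      using G1.card_edge[OF e] fV by simp
    then show ?thesis using e by (simp add: ecc_entry_VE sum_subtractf flip: sum_distrib_left)
  qed
  have EE: "(\<Sum>f\<in>edges G1. ecc_entry H (Inl (Inr e)) (Inl (Inr f))) = 4 * real q1 - 8 * real r1 + 4"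
    if e: "e \<in> edges G1" for e
  proof -
    have "edges G1 \<inter> {f. e = f} = {e}" using e by blast
    then have "(\<Sum>f\<in>edges G1. of_bool (e = f)) = (1 :: real)" using fE by simp
    then show ?thesis
      using e by (simp add: ecc_entry_EE sum.distrib sum_subtractf sum_edges_card_inter flip: sum_distrib_left)
  qed
  have WW: "(\<Sum>w'\<in>pverts G2. ecc_entry H (Inr w) (Inr w')) = 2 * (real p2 - real r2 - 1)"
    if w: "w \<in> pverts G2" for w
  proof -
    have "pverts G2 \<inter> {w'. w = w'} = {w}" using w by blast
    then have 1: "(\<Sum>w'\<in>pverts G2. of_bool (w = w')) = (1 :: real)" using fW by simp
    have "pverts G2 \<inter> {w'. (w, w') \<in> parcs G2} = {w'. (w, w') \<in> parcs G2}"
      by (auto dest: G2.in_arcsD2)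
    then have "(\<Sum>w'\<in>pverts G2. adj_entry G2 w w') = real r2"
      using fW G2.card_neighbours[OF reg2 w] by (simp add: adj_entry_def flip: of_bool_def)
    with 1 show ?thesis
      using w by (simp add: ecc_entry_WW sum.distrib sum_subtractf flip: sum_distrib_left)
  qed
  have "partition_on (pverts H) (set blocks)"
    using V1 V2 edges_nonempty
    by (intro partition_onI) (auto simp: blocks_def pverts_subdivision_vertex_join disjnt_def)
  moreover have "distinct blocks"
    using V1 V2 edges_nonempty by (auto simp: blocks_def)
  moreover have "(\<Sum>v\<in>blocks ! j. ecc_entry H u v) = quotient_mat $$ (i, j)"
    if "i < 3" "j < 3" and u: "u \<in> blocks ! i" for i j u
  proof -
    have "i = 0 \<or> i = 1 \<or> i = 2" "j = 0 \<or> j = 1 \<or> j = 2" using that by auto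
    then show ?thesis
      using u
      by (elim disjE) (auto simp: blocks_def quotient_mat_simps sum.reindex inj_on_def
          ecc_entry_VV ecc_entry_VW ecc_entry_EW VE EV EE WW)
  qed
  moreover have "length blocks = 3" by (simp add: blocks_def)
  ultimately show ?thesis
    using quotient_mat_carrier by (simp add: equitable_quotient_def)
qed

end

section \<open>The spectrum\<close>

context regular_join
begin

text \<open>The constant terms of the closed-form entries, block by block.\<close>

definition block_constant :: "nat \<Rightarrow> nat \<Rightarrow> complex" where
  "block_constant i j = [[0, 3, 0], [3, 4, 2], [0, 2, 2]] ! i ! j"

text \<open>The quotient matrix with its block-size terms removed, that is, the block row sums of
  \<open>reduced_entry\<close>.\<close>

definition reduced_quotient :: "nat \<Rightarrow> nat \<Rightarrow> complex" where
  "reduced_quotient i j =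
    [[0, - 3 * of_nat r1, 0], [- 6, 4 - 8 * of_nat r1, 0], [0, 0, - 2 - 2 * of_nat r2]] ! i ! j"

definition reduced_entry :: "('a + 'a set) + 'b \<Rightarrow> ('a + 'a set) + 'b \<Rightarrow> complex" where
  "reduced_entry x y = complex_of_real (ecc_entry H x y) - block_constant (join_block x) (join_block y)"

text \<open>The quadratic \<open>x (x - 4) - (9 - 4 x) (a + r1)\<close>, coefficients from the
  constant term upwards: the contribution of an eigenvalue \<open>a\<close> of \<open>G1\<close> to
  the reduced matrix.\<close>

definition edge_factor :: "complex \<Rightarrow> complex poly" where
  "edge_factor a = [:- 9 * (a + of_nat r1), - 4 * (1 - (a + of_nat r1)), 1:]"

lemma blocks_eq:
  assumes "j \<in> {0, 1, 2}"
  shows "{v \<in> pverts H. join_block v = j} = blocks ! j"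
  using assms by (auto simp: blocks_def pverts_subdivision_vertex_join)

lemma reduced_quotient_eq:
  assumes "i \<in> {0, 1, 2}" "j \<in> {0, 1, 2}"
  shows "complex_of_real (quotient_mat $$ (i, j)) = reduced_quotient i j + block_constant i j * of_nat (card (blocks ! j))"
proof -
  have "card (Inl ` Inl ` pverts G1 :: (('a + 'a set) + 'b) set) = p1"
    "card (Inl ` Inr ` edges G1 :: (('a + 'a set) + 'b) set) = q1"
    "card (Inr ` pverts G2 :: (('a + 'a set) + 'b) set) = p2"
    by (simp_all add: card_image inj_on_def image_image)
  then show ?thesis
    using assms
    by (auto simp: quotient_mat_simps reduced_quotient_def block_constant_def blocks_def algebra_simps)
qed

lemma sum_reduced_entry:
  assumes x: "x \<in> pverts H" and j: "j \<in> {0, 1, 2}"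
  shows "(\<Sum>y | y \<in> pverts H \<and> join_block y = j. reduced_entry x y) = reduced_quotient (join_block x) j"
proof -
  have i: "join_block x \<in> {0, 1, 2}" using x by (cases rule: join_vertex_cases) auto
  have "length blocks = 3" by (simp add: blocks_def)
  with equitable_join have "\<forall>i<3. \<forall>j<3. \<forall>u\<in>blocks ! i. (\<Sum>v\<in>blocks ! j. ecc_entry H u v) = quotient_mat $$ (i, j)"
    by (simp add: equitable_quotient_def)
  moreover have "x \<in> blocks ! join_block x" using x blocks_eq[OF i] by blast
  moreover have "join_block x < 3" "j < 3" using i j by auto
  ultimately have row: "(\<Sum>y\<in>blocks ! j. ecc_entry H x y) = quotient_mat $$ (join_block x, j)"
    by blast
  have "(\<Sum>y | y \<in> pverts H \<and> join_block y = j. reduced_entry x y)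
      = (\<Sum>y\<in>blocks ! j. complex_of_real (ecc_entry H x y) - block_constant (join_block x) j)"
    unfolding blocks_eq[OF j, symmetric] by (rule sum.cong) (auto simp: reduced_entry_def)
  also have "\<dots> = complex_of_real (quotient_mat $$ (join_block x, j))
      - block_constant (join_block x) j * of_nat (card (blocks ! j))"
    by (simp add: sum_subtractf mult.commute flip: row)
  finally show ?thesis using reduced_quotient_eq[OF i j] by simp
qed

lemma char_poly_ecc_reduced:
  assumes vs: "distinct vs" "set vs = pverts H"
  shows "char_poly (indexed_mat vs vs (\<lambda>x y. complex_of_real (ecc_entry H x y)))
      * char_poly (indexed_mat [0, 1, 2] [0, 1, 2] reduced_quotient)
    = char_poly (indexed_mat vs vs reduced_entry) * char_poly (map_mat complex_of_real quotient_mat)"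
proof -
  have "map_mat complex_of_real quotient_mat
      = indexed_mat [0, 1, 2] [0, 1, 2] (\<lambda>i j. complex_of_real (quotient_mat $$ (i, j)))"
    using quotient_mat_carrier
    by (intro eq_matI) (auto simp: numeral_3_eq_3 numeral_2_eq_2 less_Suc_eq)
  moreover have "char_poly (indexed_mat vs vs (\<lambda>x y. complex_of_real (ecc_entry H x y)))
      * char_poly (indexed_mat [0, 1, 2] [0, 1, 2] reduced_quotient)
    = char_poly (indexed_mat vs vs reduced_entry)
      * char_poly (indexed_mat [0, 1, 2] [0, 1, 2] (\<lambda>i j. complex_of_real (quotient_mat $$ (i, j))))"
  proof (rule char_poly_add_block_constant[where bl = join_block and C = block_constant])
    show "join_block ` set vs \<subseteq> set [0, 1, 2]"
      unfolding vs by (auto elim!: join_vertex_cases)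
    show "(\<Sum>y | y \<in> set vs \<and> join_block y = j. reduced_entry x y) = reduced_quotient (join_block x) j"
      if "x \<in> set vs" "j \<in> set [0, 1, 2]" for x j
      using sum_reduced_entry[of x j] that by (simp add: vs)
    show "complex_of_real (quotient_mat $$ (i, j))
        = reduced_quotient i j + block_constant i j * of_nat (card {v \<in> set vs. join_block v = j})"
      if "i \<in> set [0, 1, 2]" "j \<in> set [0, 1, 2]" for i j
      using reduced_quotient_eq[of i j] blocks_eq[of j] that by (simp add: vs)
  qed (simp_all add: vs reduced_entry_def)
  ultimately show ?thesis by simp
qed

text \<open>The reduced quotient is block diagonal with blocks of sizes 2 and 1. Its factors are
  those that the eigenvalues \<open>r1\<close> of \<open>G1\<close> and \<open>r2\<close> of
  \<open>G2\<close> contribute to the reduced matrix, so they cancel later.\<close>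

lemma char_poly_reduced_quotient:
  "char_poly (indexed_mat [0, 1, 2] [0, 1, 2] reduced_quotient) = edge_factor (of_nat r1) * [:2 + 2 * of_nat r2, 1:]"
proof (rule poly_eq_poly_eq_iff[THEN iffD1], rule ext)
  fix x :: complex
  let ?F = "\<lambda>u v. (if u = v then x else 0) - reduced_quotient u v"
  have *: "indexed_mat [0, 1, 2] [0, 1, 2] ?F = four_block_mat
     (four_block_mat (indexed_mat [0] [0] ?F) (indexed_mat [0] [1] ?F) (indexed_mat [1] [0] ?F) (indexed_mat [1] [1] ?F))
     (indexed_mat [0, 1] [2] ?F) (indexed_mat [2] [0, 1] ?F) (indexed_mat [2] [2] ?F)"
    using indexed_mat_append[of "[0, 1]" "[2]" "[0, 1]" "[2]" ?F] indexed_mat_append[of "[0]" "[1]" "[0]" "[1]" ?F]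
    by simp
  have "poly (char_poly (indexed_mat [0, 1, 2] [0, 1, 2] reduced_quotient)) x
     = det (indexed_mat [0, 1, 2] [0, 1, 2] ?F)"
    by (rule poly_char_poly_indexed_mat) simp
  also have "\<dots> = det (four_block_mat (indexed_mat [0] [0] ?F) (indexed_mat [0] [1] ?F) (indexed_mat [1] [0] ?F) (indexed_mat [1] [1] ?F))
      * det (indexed_mat [2] [2] ?F)"
    unfolding *
    by (rule det_four_block_mat_upper_right_zero[of _ 2 _ 1])
      (auto simp: reduced_quotient_def numeral_2_eq_2 intro!: carrier_matI eq_matI simp: less_Suc_eq)
  also have "det (indexed_mat [2] [2] ?F) = x + 2 + 2 * of_nat r2"
    by (subst det_single) (auto simp: reduced_quotient_def intro!: carrier_matI)
  also have "det (four_block_mat (indexed_mat [0] [0] ?F) (indexed_mat [0] [1] ?F) (indexed_mat [1] [0] ?F) (indexed_mat [1] [1] ?F))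
     = det (indexed_mat [0] [0] ?F * indexed_mat [1] [1] ?F - indexed_mat [0] [1] ?F * indexed_mat [1] [0] ?F)"
    by (rule det_four_block_mat[of _ 1])
      (auto simp: scalar_prod_def mult.commute intro!: carrier_matI eq_matI)
  also have "\<dots> = x * (x - 4 + 8 * of_nat r1) - 18 * of_nat r1"
    by (subst det_single) (auto simp: scalar_prod_def reduced_quotient_def intro!: carrier_matI)
  finally show "poly (char_poly (indexed_mat [0, 1, 2] [0, 1, 2] reduced_quotient)) x
     = poly (edge_factor (of_nat r1) * [:2 + 2 * of_nat r2, 1:]) x"
    by (simp add: edge_factor_def algebra_simps)
qed

text \<open>Removing the block constants decouples \<open>G2\<close> from the rest, so the
  determinant splits. \<open>det_incidence_block\<close> with \<open>b = 3\<close>,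
  \<open>d = 4\<close> and \<open>y = x - 4\<close> handles the part of \<open>G1\<close>; its
  factor \<open>y ^ p\<close> is the power of \<open>[:- 4, 1:]\<close> on the left.\<close>

lemma char_poly_reduced_entry:
  fixes vs1 :: "'a list" and es :: "'a set list" and vs2 :: "'b list"
  defines "vs \<equiv> (map (\<lambda>v. Inl (Inl v)) vs1 @ map (\<lambda>e. Inl (Inr e)) es) @ map Inr vs2"
    and "A1 \<equiv> indexed_mat vs1 vs1 (\<lambda>u v. complex_of_real (adj_entry G1 u v))"
    and "A2 \<equiv> indexed_mat vs2 vs2 (\<lambda>u v. complex_of_real (adj_entry G2 u v))"
  assumes vs1: "distinct vs1" "set vs1 = pverts G1"
    and es: "distinct es" "set es = edges G1"
    and vs2: "distinct vs2" "set vs2 = pverts G2"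
  shows "char_poly (indexed_mat vs vs reduced_entry) * [:- 4, 1:] ^ p1
    = [:- 4, 1:] ^ q1 * (\<Prod>a\<in>#proots (char_poly A1). edge_factor a)
      * (\<Prod>b\<in>#proots (char_poly A2). [:2 + 2 * b, 1:])"
proof (rule poly_eq_poly_eq_iff[THEN iffD1], rule ext)
  fix x :: complex
  have len: "length vs1 = p1" "length es = q1" "length vs2 = p2"
    using vs1 es vs2 by (metis distinct_card)+
  have dist: "distinct vs"
    using vs1 es vs2 by (auto simp: vs_def distinct_map inj_on_def)
  let ?F = "\<lambda>u v. (if u = v then x else 0) - reduced_entry u v"
  let ?V = "map (\<lambda>v. Inl (Inl v)) vs1 :: (('a + 'a set) + 'b) list"
  let ?E = "map (\<lambda>e. Inl (Inr e)) es :: (('a + 'a set) + 'b) list"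
  let ?W = "map Inr vs2 :: (('a + 'a set) + 'b) list"
  define R where "R = indexed_mat vs1 es (\<lambda>v e. of_bool (v \<in> e) :: complex)"
  define T where "T = indexed_mat es vs1 (\<lambda>e v. of_bool (v \<in> e) :: complex)"
  have RT: "R * T = indexed_mat vs1 vs1 (\<lambda>u v. of_nat (if u = v then r1 else of_bool ((u, v) \<in> parcs G1)))"
    unfolding R_def T_def indexed_mat_mult[OF es(1)]
    by (rule indexed_mat_cong) (simp only: es vs1 G1.sum_incidence_edges[OF reg1])
  have TR: "T * R = indexed_mat es es (\<lambda>e f. of_nat (card (e \<inter> f)))"
    unfolding R_def T_def indexed_mat_mult[OF vs1(1)]
    by (rule indexed_mat_cong) (simp only: es vs1 G1.sum_incidence_verts)
  have carr: "R \<in> carrier_mat p1 q1" "T \<in> carrier_mat q1 p1" "A1 \<in> carrier_mat p1 p1" "A2 \<in> carrier_mat p2 p2"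
    by (simp_all add: R_def T_def A1_def A2_def len carrier_matI)
  note one1 = one_mat_eq_indexed_mat[OF vs1(1), unfolded len]
    and oneE = one_mat_eq_indexed_mat[OF es(1), unfolded len]
    and one2 = one_mat_eq_indexed_mat[OF vs2(1), unfolded len]
  have VV: "indexed_mat ?V ?V ?F = x \<cdot>\<^sub>m 1\<^sub>m p1"
    unfolding indexed_mat_map one1 smult_indexed_mat
    by (rule indexed_mat_cong) (simp add: vs1 reduced_entry_def block_constant_def ecc_entry_VV)
  have VE: "indexed_mat ?V ?E ?F = 3 \<cdot>\<^sub>m R"
    unfolding indexed_mat_map R_def smult_indexed_mat
    by (rule indexed_mat_cong) (simp add: vs1 es reduced_entry_def block_constant_def ecc_entry_VE)
  have EV: "indexed_mat ?E ?V ?F = 3 \<cdot>\<^sub>m T"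
    unfolding indexed_mat_map T_def smult_indexed_mat
    by (rule indexed_mat_cong) (simp add: vs1 es reduced_entry_def block_constant_def ecc_entry_VE)
  have EE: "indexed_mat ?E ?E ?F = (x - 4) \<cdot>\<^sub>m 1\<^sub>m q1 + 4 \<cdot>\<^sub>m (T * R)"
    unfolding indexed_mat_map oneE TR smult_indexed_mat plus_indexed_mat
    by (rule indexed_mat_cong) (simp add: es reduced_entry_def block_constant_def ecc_entry_EE)
  \<comment> \<open>The double negation brings the block into the form required by
    \<open>det_scalar_minus_smult\<close>.\<close>
  have WW: "indexed_mat ?W ?W ?F = (x + 2) \<cdot>\<^sub>m 1\<^sub>m p2 - (- 2) \<cdot>\<^sub>m A2"
    unfolding indexed_mat_map one2 A2_def smult_indexed_mat minus_indexed_mat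
    by (rule indexed_mat_cong) (simp add: vs2 reduced_entry_def block_constant_def ecc_entry_WW)
  let ?B = "four_block_mat (x \<cdot>\<^sub>m 1\<^sub>m p1) (3 \<cdot>\<^sub>m R) (3 \<cdot>\<^sub>m T) ((x - 4) \<cdot>\<^sub>m 1\<^sub>m q1 + 4 \<cdot>\<^sub>m (T * R))"
  have "poly (char_poly (indexed_mat vs vs reduced_entry)) x = det (indexed_mat vs vs ?F)"
    by (rule poly_char_poly_indexed_mat[OF dist])
  also have "indexed_mat vs vs ?F = four_block_mat ?B (indexed_mat (?V @ ?E) ?W ?F) (indexed_mat ?W (?V @ ?E) ?F)
      ((x + 2) \<cdot>\<^sub>m 1\<^sub>m p2 - (- 2) \<cdot>\<^sub>m A2)"
    unfolding vs_def indexed_mat_append[of "?V @ ?E" ?W] WW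
    unfolding indexed_mat_append[of ?V ?E ?V ?E] VV VE EV EE ..
  also have "det \<dots> = det ?B * det ((x + 2) \<cdot>\<^sub>m 1\<^sub>m p2 - (- 2) \<cdot>\<^sub>m A2)"
  proof (rule det_four_block_mat_upper_right_zero[of _ "p1 + q1" _ p2])
    show "indexed_mat (?V @ ?E) ?W ?F = 0\<^sub>m (p1 + q1) p2"
      by (subst indexed_mat_eq_zero)
        (auto simp: len vs1 es vs2 reduced_entry_def block_constant_def ecc_entry_VW ecc_entry_EW)
  qed (use carr in \<open>auto simp: len intro!: carrier_matI\<close>)
  also have "det ((x + 2) \<cdot>\<^sub>m 1\<^sub>m p2 - (- 2) \<cdot>\<^sub>m A2) = (\<Prod>b\<in>#proots (char_poly A2). x + 2 + 2 * b)"
    by (subst det_scalar_minus_smult[OF carr(4)]) simp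
  finally have "poly (char_poly (indexed_mat vs vs reduced_entry)) x * (x - 4) ^ p1
      = det ?B * (x - 4) ^ p1 * (\<Prod>b\<in>#proots (char_poly A2). x + 2 + 2 * b)"
    by simp
  also have "det ?B * (x - 4) ^ p1
      = (x - 4) ^ q1 * det ((x * (x - 4)) \<cdot>\<^sub>m 1\<^sub>m p1 - (3\<^sup>2 - 4 * x) \<cdot>\<^sub>m (R * T))"
    by (rule det_incidence_block[OF carr(1,2)]) simp
  \<comment> \<open>Here \<open>R * T = A1 + r1 I\<close> is substituted, so that only the spectrum
    of \<open>A1\<close> matters.\<close>
  also have "(x * (x - 4)) \<cdot>\<^sub>m 1\<^sub>m p1 - (3\<^sup>2 - 4 * x) \<cdot>\<^sub>m (R * T)
      = (x * (x - 4) - (9 - 4 * x) * of_nat r1) \<cdot>\<^sub>m 1\<^sub>m p1 - (9 - 4 * x) \<cdot>\<^sub>m A1"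
    unfolding RT one1 A1_def smult_indexed_mat minus_indexed_mat using G1.pair_no_loops[of "(_, _)"]
    by (intro indexed_mat_cong) (auto simp: adj_entry_def)
  also have "det \<dots> = (\<Prod>a\<in>#proots (char_poly A1). x * (x - 4) - (9 - 4 * x) * of_nat r1 - (9 - 4 * x) * a)"
    by (rule det_scalar_minus_smult[OF carr(3)])
  also have "\<dots> = (\<Prod>a\<in>#proots (char_poly A1). poly (edge_factor a) x)"
    by (intro arg_cong[where f = prod_mset] image_mset_cong) (simp add: edge_factor_def algebra_simps)
  finally show "poly (char_poly (indexed_mat vs vs reduced_entry) * [:- 4, 1:] ^ p1) x
      = poly ([:- 4, 1:] ^ q1 * (\<Prod>a\<in>#proots (char_poly A1). edge_factor a)
        * (\<Prod>b\<in>#proots (char_poly A2). [:2 + 2 * b, 1:])) x"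
    by (simp add: poly_prod_mset image_mset.compositionality o_def add.commute algebra_simps)
qed

text \<open>The simplified form of the value obtained from \<open>t2\<close>: the factor
  \<open>-3\<close> reverses the sign of the root, so \<open>t2\<close> gives the upper and
  \<open>t1\<close> the lower of the two values.\<close>

definition upper_eigenvalue :: "real \<Rightarrow> real" where
  "upper_eigenvalue a = 2 * (1 - (a + r1)) + sqrt (4 * (a + r1)\<^sup>2 + (a + r1) + 4)"

definition lower_eigenvalue :: "real \<Rightarrow> real" where
  "lower_eigenvalue a = 2 * (1 - (a + r1)) - sqrt (4 * (a + r1)\<^sup>2 + (a + r1) + 4)"

text \<open>Vieta: with \<open>s = a + r1\<close>, the two values have sum \<open>4 (1 - s)\<close>
  and product \<open>- 9 s\<close>.\<close>

lemma edge_factor_of_real: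
  "edge_factor (complex_of_real a)
    = [:- complex_of_real (upper_eigenvalue a), 1:] * [:- complex_of_real (lower_eigenvalue a), 1:]"
proof -
  define s where "s = a + real r1"
  \<comment> \<open>Completing the square shows that the radicand is positive for every real
    \<open>s\<close>, so squaring undoes the root.\<close>
  have "4 * s\<^sup>2 + s + 4 = (2 * s + 1 / 4)\<^sup>2 + (63 / 16 :: real)"
    by (simp add: power2_eq_square algebra_simps)
  then have "0 \<le> 4 * s\<^sup>2 + s + 4" by simp
  then have sq: "(sqrt (4 * s\<^sup>2 + s + 4))\<^sup>2 = 4 * s\<^sup>2 + s + 4" by simp
  have "upper_eigenvalue a * lower_eigenvalue a = (2 * (1 - s))\<^sup>2 - (sqrt (4 * s\<^sup>2 + s + 4))\<^sup>2"
    by (simp add: upper_eigenvalue_def lower_eigenvalue_def s_def power2_eq_square algebra_simps)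
  then have "upper_eigenvalue a * lower_eigenvalue a = - 9 * s"
    unfolding sq by (simp add: power2_eq_square algebra_simps)
  moreover have "- upper_eigenvalue a - lower_eigenvalue a = - 4 * (1 - s)"
    by (simp add: upper_eigenvalue_def lower_eigenvalue_def s_def)
  ultimately have "complex_of_real (upper_eigenvalue a) * complex_of_real (lower_eigenvalue a) = complex_of_real (- 9 * s)"
    "- complex_of_real (upper_eigenvalue a) - complex_of_real (lower_eigenvalue a) = complex_of_real (- 4 * (1 - s))"
    unfolding of_real_mult[symmetric] of_real_minus[symmetric] of_real_diff[symmetric] by (simp_all only:)
  note coeffs = this[symmetric]
  have "edge_factor (complex_of_real a) = [:complex_of_real (- 9 * s), complex_of_real (- 4 * (1 - s)), 1:]"
    by (simp add: edge_factor_def s_def)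
  then show ?thesis unfolding coeffs by simp
qed

text \<open>From \<open>2 * q1 = r1 * p1\<close> and \<open>r1\<close> at least 2; the
  natural-number difference \<open>q1 - p1\<close> is therefore a true difference.\<close>

lemma card_verts_le_card_edges: "p1 \<le> q1"
  using G1.handshake[OF reg1] mult_le_mono1[OF r1, of p1] by simp

lemma proots_char_poly_ecc:
  assumes vs: "distinct vs" "set vs = pverts H"
    and vs1: "distinct vs1" "set vs1 = pverts G1"
    and vs2: "distinct vs2" "set vs2 = pverts G2"
    and spec1: "proots (char_poly (indexed_mat vs1 vs1 (\<lambda>u v. complex_of_real (adj_entry G1 u v))))
      = {#of_nat r1#} + {#complex_of_real (lam i). i \<in># I#}"
    and spec2: "proots (char_poly (indexed_mat vs2 vs2 (\<lambda>u v. complex_of_real (adj_entry G2 u v))))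
      = {#of_nat r2#} + {#complex_of_real (\<beta> k). k \<in># K#}"
  shows "proots (char_poly (indexed_mat vs vs (\<lambda>x y. complex_of_real (ecc_entry H x y))))
    = replicate_mset (q1 - p1) 4 + {#complex_of_real (- 2 * (1 + \<beta> k)). k \<in># K#}
      + {#complex_of_real (lower_eigenvalue (lam i)). i \<in># I#}
      + {#complex_of_real (upper_eigenvalue (lam i)). i \<in># I#}
      + proots (char_poly (map_mat complex_of_real quotient_mat))"
proof -
  obtain es where es: "distinct es" "set es = edges G1"
    using finite_distinct_list[OF finite_edges[OF G1.pair_graph_axioms]] by blast
  \<comment> \<open>An order adapted to the blocks; the given order \<open>vs\<close> is restored at
    the end by a permutation similarity.\<close>
  define us where "us = (map (\<lambda>v. Inl (Inl v)) vs1 @ map (\<lambda>e. Inl (Inr e)) es) @ map (Inr :: 'b \<Rightarrow> ('a + 'a set) + 'b) vs2"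
  have us: "distinct us" "set us = pverts H"
    using vs1 es vs2 by (auto simp: us_def distinct_map inj_on_def pverts_subdivision_vertex_join)
  let ?P = "char_poly (indexed_mat us us (\<lambda>x y. complex_of_real (ecc_entry H x y)))"
  let ?N = "char_poly (indexed_mat us us reduced_entry)"
  let ?Q = "char_poly (map_mat complex_of_real quotient_mat)"
  let ?X = "[:- 4, 1:] :: complex poly"
  let ?F = "edge_factor (of_nat r1)" and ?L = "[:2 + 2 * of_nat r2, 1:] :: complex poly"
  let ?upper = "\<Prod>i\<in>#I. [:- complex_of_real (upper_eigenvalue (lam i)), 1:]"
  let ?lower = "\<Prod>i\<in>#I. [:- complex_of_real (lower_eigenvalue (lam i)), 1:]"
  let ?beta = "\<Prod>k\<in>#K. [:- complex_of_real (- 2 * (1 + \<beta> k)), 1:]"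
  have PN: "?P * (?F * ?L) = ?N * ?Q"
    using char_poly_ecc_reduced[OF us] unfolding char_poly_reduced_quotient .
  have "?N * ?X ^ p1 = ?X ^ q1 * (?F * (\<Prod>i\<in>#I. edge_factor (complex_of_real (lam i))))
      * (?L * (\<Prod>k\<in>#K. [:2 + 2 * complex_of_real (\<beta> k), 1:]))"
    using char_poly_reduced_entry[OF vs1 es vs2, unfolded spec1 spec2, folded us_def]
    by (simp add: image_mset.compositionality o_def)
  also have "(\<Prod>i\<in>#I. edge_factor (complex_of_real (lam i))) = ?upper * ?lower"
    unfolding edge_factor_of_real by (rule prod_mset.distrib)
  also have "(\<Prod>k\<in>#K. [:2 + 2 * complex_of_real (\<beta> k), 1:]) = ?beta"
    by (intro arg_cong[where f = prod_mset] image_mset_cong) simp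
  also have "?X ^ q1 = ?X ^ p1 * ?X ^ (q1 - p1)"
    using card_verts_le_card_edges by (simp flip: power_add)
  finally have N: "?N * ?X ^ p1 = ?X ^ p1 * ?X ^ (q1 - p1) * (?F * (?upper * ?lower)) * (?L * ?beta)" .
  \<comment> \<open>Both sides are brought to a common nonzero factor: \<open>?F\<close> and
    \<open>?L\<close> from the eigenvalues \<open>r1\<close> and \<open>r2\<close>, and
    \<open>?X ^ p1\<close> from the Schur complement. Cancelling it avoids any division of
    polynomials.\<close>
  have "(?F * ?L * ?X ^ p1) * ?P = ?P * (?F * ?L) * ?X ^ p1" by (simp only: ac_simps)
  also have "\<dots> = ?N * ?X ^ p1 * ?Q" unfolding PN by (simp only: ac_simps)
  also have "\<dots> = (?F * ?L * ?X ^ p1) * (?X ^ (q1 - p1) * ?beta * ?lower * ?upper * ?Q)"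
    unfolding N by (simp only: ac_simps)
  finally have "(?F * ?L * ?X ^ p1) * ?P = \<dots>" .
  moreover have "?F \<noteq> 0" by (simp add: edge_factor_def)
  then have "?F * ?L * ?X ^ p1 \<noteq> 0" by (simp del: mult_pCons_left mult_pCons_right)
  ultimately have "?P = ?X ^ (q1 - p1) * ?beta * ?lower * ?upper * ?Q"
    using mult_left_cancel by blast
  moreover have "?beta \<noteq> 0" "?lower \<noteq> 0" "?upper \<noteq> 0" by (auto simp: prod_mset_zero_iff)
  moreover have "?Q \<noteq> 0"
    by (rule char_poly_nonzero[of _ 3]) (simp add: quotient_mat_carrier)
  ultimately have "proots ?P = repeat_mset (q1 - p1) {#4#} + proots ?beta + proots ?lower + proots ?upper + proots ?Q"
    by (simp add: proots_mult proots_power)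
  also have "repeat_mset (q1 - p1) {#4 :: complex#} = replicate_mset (q1 - p1) 4"
    by (rule multiset_eqI) simp
  finally show ?thesis
    unfolding proots_prod_linear_factors char_poly_indexed_mat_reorder[OF us(1) vs(1) us(2)[folded vs(2)]] .
qed

end

lemma verts_nonempty_if_connected: "Digraph_Component.connected (with_proj G) \<Longrightarrow> pverts G \<noteq> {}"
  by (simp add: Digraph_Component.connected_def strongly_connected_def)

theorem theorem3p2:
  fixes G1 :: "'a pair_pre_digraph" and G2 :: "'b pair_pre_digraph"
    and r1 p1 q1 r2 p2 q2 :: nat
    and lam \<beta> :: "nat \<Rightarrow> real"
    and vs1 :: "'a list" and vs2 :: "'b list" and vs :: "(('a + 'a set) + 'b) list"
  assumes "pair_graph G1" and "Digraph_Component.connected (with_proj G1)" and "regular r1 G1"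
    and "p1 = card (pverts G1)" and "q1 = card (edges G1)"
    and "pair_graph G2" and "Digraph_Component.connected (with_proj G2)" and "regular r2 G2"
    and "p2 = card (pverts G2)" and "q2 = card (edges G2)"
    and "r1 \<ge> 2"
    and "distinct vs1" and "set vs1 = pverts G1"
    and "distinct vs2" and "set vs2 = pverts G2"
    and "eigenvalues_mset (vertex_mat vs1 (adj_entry G1)) =
           {# of_nat r1 #} + {# complex_of_real (lam i). i \<in># mset_set {2..p1} #}"
    and "eigenvalues_mset (vertex_mat vs2 (adj_entry G2)) =
           {# of_nat r2 #} + {# complex_of_real (\<beta> k). k \<in># mset_set {2..p2} #}"
    and "distinct vs" and "set vs = pverts (subdivision_vertex_join G1 G2)"
  shows "let Q = mat_of_rows_list 3
           [[0, 3 * real q1 - 3 * real r1, 0],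
            [3 * real p1 - 6, 4 * real q1 - 8 * real r1 + 4, 2 * real p2],
            [0, 2 * real q1, 2 * (real p2 - real r2 - 1)]]
         in eigenvalues_mset (vertex_mat vs (ecc_entry (subdivision_vertex_join G1 G2))) =
              replicate_mset (q1 - p1) 4
            + {# complex_of_real (- 2 * (1 + \<beta> k)). k \<in># mset_set {2..p2} #}
            + {# complex_of_real
                  (let t1 = (2 * (1 - (lam i + real r1))
                        + sqrt (4 * (lam i + real r1)\<^sup>2 + (lam i + real r1) + 4)) / 3
                   in - 3 * t1 + 4 - 4 * (lam i + real r1)). i \<in># mset_set {2..p1} #}
            + {# complex_of_real
                  (let t2 = (2 * (1 - (lam i + real r1))
                        - sqrt (4 * (lam i + real r1)\<^sup>2 + (lam i + real r1) + 4)) / 3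
                   in - 3 * t2 + 4 - 4 * (lam i + real r1)). i \<in># mset_set {2..p1} #}
            + eigenvalues_mset Q
          \<and> equitable_quotient (pverts (subdivision_vertex_join G1 G2))
              (ecc_entry (subdivision_vertex_join G1 G2))
              [Inl ` Inl ` pverts G1, Inl ` Inr ` edges G1, Inr ` pverts G2] Q"
proof -
  interpret J: regular_join G1 G2 r1 r2
    using assms(1,3,6,8,11) verts_nonempty_if_connected[OF assms(2)] verts_nonempty_if_connected[OF assms(7)]
    by (simp add: regular_join_def regular_join_axioms_def)
  have spec: "proots (char_poly (indexed_mat vs1 vs1 (\<lambda>u v. complex_of_real (adj_entry G1 u v))))
      = {#of_nat r1#} + {#complex_of_real (lam i). i \<in># mset_set {2..p1}#}"
    "proots (char_poly (indexed_mat vs2 vs2 (\<lambda>u v. complex_of_real (adj_entry G2 u v))))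
      = {#of_nat r2#} + {#complex_of_real (\<beta> k). k \<in># mset_set {2..p2}#}"
    using assms(16,17) by (simp_all add: eigenvalues_mset_vertex_mat)
  \<comment> \<open>Since \<open>4 - 4 s = 2 * (2 (1 - s))\<close>, subtracting \<open>3 t\<close>
    leaves \<open>2 (1 - s)\<close> with the root of opposite sign, where
    \<open>s = a + r1\<close>.\<close>
  have eigenvalues: "- 3 * ((2 * (1 - (a + real r1)) + sqrt D) / 3) + 4 - 4 * (a + real r1) = 2 * (1 - (a + r1)) - sqrt D"
    "- 3 * ((2 * (1 - (a + real r1)) - sqrt D) / 3) + 4 - 4 * (a + real r1) = 2 * (1 - (a + r1)) + sqrt D" for a D
    by (simp_all add: field_simps)
  show ?thesis
    using J.proots_char_poly_ecc[OF assms(18,19,12,13,14,15) spec] J.equitable_join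
    unfolding Let_def eigenvalues eigenvalues_mset_vertex_mat
    unfolding J.lower_eigenvalue_def J.upper_eigenvalue_def J.quotient_mat_def J.blocks_def eigenvalues_mset_def
      assms(4,5,9)
    by (rule conjI)
qed

end
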